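(* Let $g\ge 1$. For every $f\in \mathrm{Sp}(g,\mathbb{Z})$ we have $$s(f)=i^{-n(f)},$$ where $s$ is the Lion–Vergne function and $n$ is the Gilmer–Masbaum function defined in the context.
   Context: Let $V=\mathbb{R}^{2g}$ with standard basis $p_1,\dots,p_g,q_1,\dots,q_g$ and symplectic form $\omega$ given by $\omega(p_i,p_j)=\omega(q_i,q_j)=0$, $\omega(p_i,q_j)=-\omega(q_i,p_j)=\delta_{ij}$. $\mathrm{Sp}(g,\mathbb{R})$ is the group of linear isometries of $(V,\omega)$; $\mathrm{Sp}(g,\mathbb{Z})\subset\mathrm{Sp}(g,\mathbb{R})$ is the subgroup preserving $\mathbb{Z}^{2g}$. A lagrangian is a subspace equal to its own $\omega$-orthogonal. Let $\lambda_0=\mathrm{span}\{p_1,\dots,p_g\}$. For $x\neq 0$ real, $\mathrm{sgn}(x)\in\{\pm1\}$ is its sign. Definition of $\epsilon$: for oriented lagrangians $\lambda_1,\lambda_2$ of a real symplectic vector space, let $\kappa=\lambda_1\cap\lambda_2$. If $\kappa=0$, $\epsilon(\lambda_1,\lambda_2)=\mathrm{sgn}(\det(\omega(a_i,b_j)))$ where $(a_i)$, $(b_j)$ are positively oriented bases of $\lambda_1$, $\lambda_2$. If $\kappa\ne0$, choose an orientation of $\kappa$; orient $\lambda_i/\kappa$ so that a positive basis of $\kappa$ followed by lifts of a positive basis of $\lambda_i/\kappa$ is a positive basis of $\lambda_i$; then $\lambda_i/\kappa$ are transverse lagrangians in the symplectic space $\kappa^\perp/\kappa$ and $\epsilon(\lambda_1,\lambda_2):=\epsilon(\lambda_1/\kappa,\lambda_2/\kappa)$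 (independent of the choice). If $\lambda_1=\lambda_2$ as subspaces, $\epsilon=1$ if the orientations agree and $-1$ otherwise. Set $s(\lambda_1,\lambda_2)=i^{\dim\lambda_1-\dim(\lambda_1\cap\lambda_2)}\epsilon(\lambda_1,\lambda_2)$, and for $f\in\mathrm{Sp}(g,\mathbb{R})$ set $s(f)=s(\lambda_0,f(\lambda_0))$, where $\lambda_0$ is given any orientation and $f(\lambda_0)$ the image orientation (the result is independent of the choice). Definition of $n$: for $f\in\mathrm{Sp}(g,\mathbb{R})$, define the bilinear form $\star_f$ on $(f-1)V$ by $a\star_f b=\omega(x,b)$ where $x$ is any vector with $(f-1)x=a$; it is nonsingular. Let $\mathrm{sgn}[\det(\star_f)]$ be the sign of the determinant of a Gram matrix of $\star_f$, with the convention $\mathrm{sgn}[\det(\star_{\mathrm{Id}})]=1$. The restriction $\star_{f,\lambda_0}$ of $\star_f$ to $\lambda_0\cap(f-1)V$ is symmetric. Define $$n(f)=\mathrm{Signature}(\star_{f,\lambda_0})-\dim((f-1)V)-\mathrm{sgn}[\det(\star_f)]+1.$$ *)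

theory Defs
  imports "HOL-Analysis.Analysis"
begin

text \<open>The symplectic space V = R^{2g}. The index type 'g (finite, nonempty, so g = CARD('g) >= 1)
  labels the basis: coordinate Inl i is the p_i-coordinate, Inr i the q_i-coordinate.\<close>

type_synonym 'g symvec = "real ^ ('g + 'g)"

definition omega :: "'g::finite symvec \<Rightarrow> 'g symvec \<Rightarrow> real" where
  "omega x y = (\<Sum>i\<in>UNIV. x $ Inl i * y $ Inr i - x $ Inr i * y $ Inl i)"

definition pvec :: "'g::finite \<Rightarrow> 'g symvec" where "pvec i = axis (Inl i) 1"
definition qvec :: "'g::finite \<Rightarrow> 'g symvec" where "qvec i = axis (Inr i) 1"

definition lambda0 :: "'g::finite symvec set" where
  "lambda0 = span (range pvec)"

definition Sp_R :: "('g::finite symvec \<Rightarrow> 'g symvec) set" where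
  "Sp_R = {f. linear f \<and> (\<forall>x y. omega (f x) (f y) = omega x y)}"

definition Zvec :: "'g::finite symvec set" where
  "Zvec = {x. \<forall>i. x $ i \<in> \<int>}"

definition Sp_Z :: "('g::finite symvec \<Rightarrow> 'g symvec) set" where
  "Sp_Z = {f \<in> Sp_R. f ` Zvec = Zvec}"

definition det_n :: "nat \<Rightarrow> (nat \<Rightarrow> nat \<Rightarrow> real) \<Rightarrow> real" where
  "det_n k M = (\<Sum>p | p permutes {..<k}. of_int (sign p) * (\<Prod>i<k. M i (p i)))"

definition sgn_int :: "real \<Rightarrow> int" where
  "sgn_int d = (if d > 0 then 1 else if d < 0 then -1 else 0)"

definition is_basis_of :: "'a::real_vector set \<Rightarrow> nat \<Rightarrow> (nat \<Rightarrow> 'a) \<Rightarrow> bool" where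
  "is_basis_of L k a \<longleftrightarrow> inj_on a {..<k} \<and> independent (a ` {..<k}) \<and> span (a ` {..<k}) = L"

definition same_orient :: "nat \<Rightarrow> (nat \<Rightarrow> 'a::real_vector) \<Rightarrow> (nat \<Rightarrow> 'a) \<Rightarrow> bool" where
  "same_orient k a d \<longleftrightarrow>
     (\<exists>P. (\<forall>j<k. d j = (\<Sum>i<k. P i j *\<^sub>R a i)) \<and> det_n k P > 0)"

definition concat_seq :: "nat \<Rightarrow> (nat \<Rightarrow> 'a) \<Rightarrow> (nat \<Rightarrow> 'a) \<Rightarrow> nat \<Rightarrow> 'a" where
  "concat_seq m c a' = (\<lambda>i. if i < m then c i else a' (i - m))"

text \<open>epsilon of the oriented lagrangians lambda_1 = span a, lambda_2 = span b, oriented by the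
  ordered bases a, b (each of k = dim lambda_i elements).  In the case kappa =/= 0, lambda_1 =/= lambda_2,
  c is a basis of kappa (giving its orientation) and a', b' are lifts of bases of lambda_i/kappa such that
  c followed by a' (resp. b') is a positive basis of lambda_1 (resp. lambda_2); the symplectic form of
  kappa^perp/kappa on the classes of a'_i, b'_j is omega(a'_i, b'_j).\<close>
definition epsilon :: "nat \<Rightarrow> (nat \<Rightarrow> 'g::finite symvec) \<Rightarrow> (nat \<Rightarrow> 'g symvec) \<Rightarrow> int" where
  "epsilon k a b =
    (let L1 = span (a ` {..<k}); L2 = span (b ` {..<k}); K = L1 \<inter> L2; m = dim K in
     if K = {0} then sgn_int (det_n k (\<lambda>i j. omega (a i) (b j)))
     else if L1 = L2 then (if same_orient k a b then 1 else -1)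
     else (let (c, a', b') = (SOME (c, a', b'). is_basis_of K m c
                 \<and> is_basis_of L1 k (concat_seq m c a') \<and> same_orient k a (concat_seq m c a')
                 \<and> is_basis_of L2 k (concat_seq m c b') \<and> same_orient k b (concat_seq m c b'))
           in sgn_int (det_n (k - m) (\<lambda>i j. omega (a' i) (b' j)))))"

definition s_pair :: "nat \<Rightarrow> (nat \<Rightarrow> 'g::finite symvec) \<Rightarrow> (nat \<Rightarrow> 'g symvec) \<Rightarrow> complex" where
  "s_pair k a b =
     \<i> ^ (dim (span (a ` {..<k})) - dim (span (a ` {..<k}) \<inter> span (b ` {..<k})))
       * of_int (epsilon k a b)"

text \<open>Lion--Vergne function: s(f) = s(lambda0, f(lambda0)) with lambda0 given some orientation
  (a chosen ordered basis) and f(lambda0) the image orientation.\<close>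
definition s_LV :: "('g::finite symvec \<Rightarrow> 'g symvec) \<Rightarrow> complex" where
  "s_LV f = (let a = (SOME a. is_basis_of (lambda0 :: 'g symvec set) CARD('g) a)
             in s_pair CARD('g) a (f \<circ> a))"

definition star :: "('g::finite symvec \<Rightarrow> 'g symvec) \<Rightarrow> 'g symvec \<Rightarrow> 'g symvec \<Rightarrow> real" where
  "star f a b = omega (SOME x. f x - x = a) b"

definition image_fm1 :: "('g::finite symvec \<Rightarrow> 'g symvec) \<Rightarrow> 'g symvec set" where
  "image_fm1 f = range (\<lambda>x. f x - x)"

definition sgn_det_star :: "('g::finite symvec \<Rightarrow> 'g symvec) \<Rightarrow> int" where
  "sgn_det_star f =
    (if image_fm1 f = {0} then 1
     else (let k = dim (image_fm1 f); b = (SOME b. is_basis_of (image_fm1 f) k b)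
           in sgn_int (det_n k (\<lambda>i j. star f (b i) (b j)))))"

definition pos_index :: "('a::real_vector \<Rightarrow> 'a \<Rightarrow> real) \<Rightarrow> 'a set \<Rightarrow> nat" where
  "pos_index B U = Max {dim S | S. subspace S \<and> S \<subseteq> U \<and> (\<forall>x\<in>S. x \<noteq> 0 \<longrightarrow> B x x > 0)}"

definition neg_index :: "('a::real_vector \<Rightarrow> 'a \<Rightarrow> real) \<Rightarrow> 'a set \<Rightarrow> nat" where
  "neg_index B U = Max {dim S | S. subspace S \<and> S \<subseteq> U \<and> (\<forall>x\<in>S. x \<noteq> 0 \<longrightarrow> B x x < 0)}"

definition signature :: "('a::real_vector \<Rightarrow> 'a \<Rightarrow> real) \<Rightarrow> 'a set \<Rightarrow> int" where
  "signature B U = int (pos_index B U) - int (neg_index B U)"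

definition n_GM :: "('g::finite symvec \<Rightarrow> 'g symvec) \<Rightarrow> int" where
  "n_GM f = signature (star f) (lambda0 \<inter> image_fm1 f) - int (dim (image_fm1 f))
             - sgn_det_star f + 1"

end

theory Submission
  imports Defs
begin

text \<open>
  Write L for \<open>lambda0\<close>, W for the image of f - 1 and N for its kernel, so that W is the
  symplectic complement of N. Counting dimensions, the radical of the form on the intersection of
  L and W has dimension r = dim (L \<inter> f L) - dim (L \<inter> N), and the theorem reduces to
  sgn det \<open>star f\<close> = (-1)^(q + r) \<epsilon>(L, f L), where q is the negative index of the restricted form.

  Both signs are read off from one matrix. Border the matrix \<omega>(a, f a') of a basis of L by vectors t
  dual to a basis of L \<inter> f L: the determinant has sign \<epsilon>(L, f L). The pairs belonging to L \<inter> N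
  split off as hyperbolic planes; the remaining t can be taken of the form (f - 1) T, and then the
  matrix is the Gram matrix of B(x, y) = \<omega>(x, (f - 1) y) on the vectors a and T, with the r rows
  of T negated. Adjoining preimages Y under f - 1 of the nonisotropic vectors of an orthogonal basis
  of L \<inter> W multiplies the determinant by the product of the B(Y, Y), whose sign is (-1)^q,
  and the vectors (f - 1) a, (f - 1) T, (f - 1) Y form a basis of W.
\<close>

section \<open>Determinants indexed by finite sets\<close>

text \<open>The two signs live on different spaces: \<epsilon> on the quotients of two lagrangians
  by their intersection, the discriminant of \<open>star f\<close> on W. Adjoining dual vectors
  instead of dividing keeps every matrix inside V. The corner formed by the dual vectors does not
  influence the determinant, so it can be filled with exactly the entries that a Gram matrix
  requires. The bridge to W is that B is the pullback of \<open>star f\<close> along f - 1, so a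
  Gram matrix of B on some vectors is a Gram matrix of \<open>star f\<close> on their images; it
  computes the discriminant as soon as these images form a basis. Bases may be changed freely
  throughout, because each change acts on both sides of a matrix and costs only a square, or else a
  determinant whose sign is the change of orientation.\<close>

definition detS :: "'a set \<Rightarrow> ('a \<Rightarrow> 'a \<Rightarrow> real) \<Rightarrow> real" where
  "detS A M = (\<Sum>p | p permutes A. of_int (sign p) * (\<Prod>i\<in>A. M i (p i)))"

text \<open>Arbitrary finite index sets allow rows to be split off, adjoined or indexed by disjoint
  sums without renumbering. No order on the set is involved, since rows and columns share
  it.\<close>

lemma det_n_eq_detS: "det_n k M = detS {..<k} M"
  by (simp add: det_n_def detS_def)

lemma detS_cong:
  assumes "\<And>i j. i \<in> A \<Longrightarrow> j \<in> A \<Longrightarrow> M i j = N i j"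
  shows "detS A M = detS A N"
  unfolding detS_def
  by (intro sum.cong refl arg_cong2[of _ _ _ _ "(*)"] prod.cong)
     (auto simp: assms permutes_in_image)

lemma detS_empty [simp]: "detS {} M = 1"
  by (simp add: detS_def)

lemma detS_permute_rows:
  assumes "finite A" "h permutes A"
  shows "detS A (\<lambda>i j. M (h i) j) = of_int (sign h) * detS A M"
proof -
  have "detS A (\<lambda>i j. M (h i) j) =
     (\<Sum>p | p permutes A. of_int (sign (p \<circ> h)) * (\<Prod>i\<in>A. M (h i) ((p \<circ> h) i)))"
    unfolding detS_def by (rule sum_permutations_compose_right[OF assms(2)])
  also have "\<dots> = (\<Sum>p | p permutes A. of_int (sign h) * (of_int (sign p) * (\<Prod>i\<in>A. M i (p i))))"
  proof (intro sum.cong refl)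
    fix p assume "p \<in> {p. p permutes A}"
    then have p: "p permutes A" by simp
    have "sign (p \<circ> h) = sign p * sign h"
      by (rule sign_compose) (use p assms permutation_permutes in blast)+
    moreover have "(\<Prod>i\<in>A. M (h i) ((p \<circ> h) i)) = (\<Prod>i\<in>A. M i (p i))"
      using prod.permute[OF assms(2), of "\<lambda>i. M i (p i)"] by (simp add: o_def)
    ultimately show "of_int (sign (p \<circ> h)) * (\<Prod>i\<in>A. M (h i) ((p \<circ> h) i)) =
         of_int (sign h) * (of_int (sign p) * (\<Prod>i\<in>A. M i (p i)))" by simp
  qed
  finally show ?thesis by (simp add: detS_def sum_distrib_left)
qed

lemma detS_swap_rows:
  assumes "finite A" "a \<in> A" "b \<in> A" "a \<noteq> b"
  shows "detS A (\<lambda>i j. M (Transposition.transpose a b i) j) = - detS A M"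
  using detS_permute_rows[OF assms(1) permutes_swap_id[OF assms(2,3)], of M] assms(4)
  by (simp add: sign_swap_id)

lemma detS_transpose:
  assumes "finite A"
  shows "detS A (\<lambda>i j. M j i) = detS A M"
proof -
  have "detS A (\<lambda>i j. M j i) =
     (\<Sum>p | p permutes A. of_int (sign (inv p)) * (\<Prod>i\<in>A. M (inv p i) i))"
    unfolding detS_def by (rule sum_permutations_inverse)
  also have "\<dots> = (\<Sum>p | p permutes A. of_int (sign p) * (\<Prod>i\<in>A. M i (p i)))"
  proof (intro sum.cong refl)
    fix p assume "p \<in> {p. p permutes A}"
    then have p: "p permutes A" by simp
    have "(\<Prod>i\<in>A. M (inv p i) i) = (\<Prod>i\<in>A. M i (p i))"
      using prod.permute[OF p, of "\<lambda>i. M (inv p i) i"] by (simp add: o_def permutes_inverses[OF p])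
    moreover have "sign (inv p) = sign p"
      using p assms permutation_permutes sign_inverse by blast
    ultimately show "of_int (sign (inv p)) * (\<Prod>i\<in>A. M (inv p i) i) =
         of_int (sign p) * (\<Prod>i\<in>A. M i (p i))" by simp
  qed
  finally show ?thesis by (simp add: detS_def)
qed

lemma detS_identical_rows:
  assumes "finite A" "a \<in> A" "b \<in> A" "a \<noteq> b" "\<And>j. j \<in> A \<Longrightarrow> M a j = M b j"
  shows "detS A M = 0"
proof -
  have "detS A (\<lambda>i j. M (Transposition.transpose a b i) j) = detS A M"
    by (rule detS_cong) (use assms(5) in \<open>auto simp: Transposition.transpose_def\<close>)
  with detS_swap_rows[OF assms(1-4), of M] show ?thesis by simp
qed

text \<open>Multilinearity in the rows: the product of sums expands over all maps \<open>h\<close>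
  from \<open>A\<close> to itself, and a repeated value of \<open>h\<close> repeats a row of
  \<open>M\<close>, so only permutations survive. Elements of \<open>PiE\<close> are
  \<open>undefined\<close> off \<open>A\<close> while permutations are the identity there;
  \<open>restrict\<close> mediates.\<close>

lemma detS_mult:
  assumes fin: "finite A"
  shows "detS A (\<lambda>i j. \<Sum>l\<in>A. P i l * M l j) = detS A P * detS A M"
proof -
  let ?D = "\<lambda>h. detS A (\<lambda>i j. M (h i) j)"
  let ?r = "\<lambda>p. restrict p A"
  have "detS A (\<lambda>i j. \<Sum>l\<in>A. P i l * M l j) =
    (\<Sum>p | p permutes A. of_int (sign p) *
        (\<Sum>h\<in>PiE A (\<lambda>_. A). (\<Prod>i\<in>A. P i (h i)) * (\<Prod>i\<in>A. M (h i) (p i))))"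
    unfolding detS_def using fin by (subst prod_sum_PiE) (auto simp: prod.distrib)
  also have "\<dots> = (\<Sum>h\<in>PiE A (\<lambda>_. A). (\<Prod>i\<in>A. P i (h i)) * ?D h)"
    unfolding detS_def sum_distrib_left
    by (subst sum.swap) (simp add: mult_ac)
  also have "\<dots> = (\<Sum>h\<in>?r ` {p. p permutes A}. (\<Prod>i\<in>A. P i (h i)) * ?D h)"
  proof (rule sum.mono_neutral_right)
    show "finite (PiE A (\<lambda>_. A))" using fin by (simp add: finite_PiE)
    show "?r ` {p. p permutes A} \<subseteq> PiE A (\<lambda>_. A)"
      by (auto simp: permutes_in_image)
    show "\<forall>h\<in>PiE A (\<lambda>_. A) - ?r ` {p. p permutes A}. (\<Prod>i\<in>A. P i (h i)) * ?D h = 0"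
    proof
      fix h assume h: "h \<in> PiE A (\<lambda>_. A) - ?r ` {p. p permutes A}"
      have "\<not> inj_on h A"
      proof
        assume inj: "inj_on h A"
        let ?p = "\<lambda>x. if x \<in> A then h x else x"
        have "h ` A \<subseteq> A" using h by auto
        then have "bij_betw h A A"
          using inj fin by (simp add: bij_betw_def endo_inj_surj)
        then have "bij_betw ?p A A" by (rule bij_betw_cong[THEN iffD1, rotated]) simp
        then have "?p permutes A" by (rule bij_imp_permutes) simp
        moreover have "h = ?r ?p" using h by (auto simp: fun_eq_iff PiE_def extensional_def)
        ultimately show False using h by blast
      qed
      then obtain a b where "a \<in> A" "b \<in> A" "a \<noteq> b" "h a = h b"
        by (auto simp: inj_on_def)
      then have "?D h = 0" by (intro detS_identical_rows[OF fin, of a b]) auto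
      then show "(\<Prod>i\<in>A. P i (h i)) * ?D h = 0" by simp
    qed
  qed
  also have "\<dots> = (\<Sum>p | p permutes A. (\<Prod>i\<in>A. P i (?r p i)) * ?D (?r p))"
  proof (rule sum.reindex_cong[OF _ refl refl])
    show "inj_on ?r {p. p permutes A}"
    proof (rule inj_onI)
      fix p q assume "p \<in> {p. p permutes A}" "q \<in> {p. p permutes A}" and eq: "?r p = ?r q"
      then have p: "p permutes A" and q: "q permutes A" by auto
      show "p = q"
      proof
        fix x
        show "p x = q x"
          using fun_cong[OF eq, of x] permutes_not_in[OF p, of x] permutes_not_in[OF q, of x]
          by (cases "x \<in> A") auto
      qed
    qed
  qed
  also have "\<dots> = (\<Sum>p | p permutes A. of_int (sign p) * (\<Prod>i\<in>A. P i (p i)) * detS A M)"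
  proof (intro sum.cong refl)
    fix p assume "p \<in> {p. p permutes A}"
    then have p: "p permutes A" by simp
    have "?D (?r p) = detS A (\<lambda>i j. M (p i) j)"
      by (rule detS_cong) simp
    then show "(\<Prod>i\<in>A. P i (?r p i)) * ?D (?r p) = of_int (sign p) * (\<Prod>i\<in>A. P i (p i)) * detS A M"
      by (simp add: detS_permute_rows[OF fin p])
  qed
  finally show ?thesis by (simp add: detS_def sum_distrib_right)
qed

lemma detS_reindex:
  assumes fin: "finite A" and bij: "bij_betw h A B"
  shows "detS B M = detS A (\<lambda>i j. M (h i) (h j))"
proof -
  have inj: "inj_on h A" using bij by (simp add: bij_betw_def)
  have "detS B M = (\<Sum>p | p permutes A. of_int (sign (map_permutation A h p)) *
      (\<Prod>i\<in>B. M i (map_permutation A h p i)))"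
    unfolding detS_def
  proof (rule sum.reindex_bij_betw[symmetric])
    have "map_permutation A h = (\<lambda>p x. if x \<in> B then h (p (inv_into A h x)) else x)"
      using bij by (auto simp: bij_betw_def map_permutation_def restrict_id_def fun_eq_iff)
    then show "bij_betw (map_permutation A h) {p. p permutes A} {p. p permutes B}"
      using bij_betw_permutations[OF bij] by simp
  qed
  also have "\<dots> = (\<Sum>p | p permutes A. of_int (sign p) * (\<Prod>i\<in>A. M (h i) (h (p i))))"
  proof (intro sum.cong refl)
    fix p assume "p \<in> {p. p permutes A}"
    then have p: "p permutes A" by simp
    have "(\<Prod>i\<in>B. M i (map_permutation A h p i)) = (\<Prod>i\<in>A. M (h i) (map_permutation A h p (h i)))"
      by (rule prod.reindex_bij_betw[OF bij, symmetric])
    also have "\<dots> = (\<Prod>i\<in>A. M (h i) (h (p i)))"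
      by (intro prod.cong refl) (simp add: map_permutation_apply inj)
    finally show "of_int (sign (map_permutation A h p)) * (\<Prod>i\<in>B. M i (map_permutation A h p i)) =
      of_int (sign p) * (\<Prod>i\<in>A. M (h i) (h (p i)))"
      using sign_map_permutation[OF inj p fin] by simp
  qed
  finally show ?thesis by (simp add: detS_def)
qed

section \<open>Expansion along sparse rows and columns\<close>

lemma detS_insert_row:
  assumes fin: "finite A" and a: "a \<notin> A" and z: "\<And>j. j \<in> A \<Longrightarrow> M a j = 0"
  shows "detS (insert a A) M = M a a * detS A M"
proof -
  have "detS (insert a A) M =
    (\<Sum>p | p permutes A. of_int (sign p) * (\<Prod>i\<in>insert a A. M i (p i)))"
    unfolding detS_def
  proof (rule sum.mono_neutral_right)
    show "finite {p. p permutes insert a A}" using fin by (simp add: finite_permutations)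
    show "{p. p permutes A} \<subseteq> {p. p permutes insert a A}"
      using permutes_subset by blast
    \<comment> \<open>A permutation that moves \<open>a\<close> picks a vanishing entry of row
      \<open>a\<close>; one that fixes \<open>a\<close> is a permutation of
      \<open>A\<close>.\<close>
    show "\<forall>p\<in>{p. p permutes insert a A} - {p. p permutes A}.
        of_int (sign p) * (\<Prod>i\<in>insert a A. M i (p i)) = 0"
    proof
      fix p assume p: "p \<in> {p. p permutes insert a A} - {p. p permutes A}"
      then have p1: "p permutes insert a A" and p2: "\<not> p permutes A" by auto
      have "p a \<noteq> a"
      proof
        assume "p a = a"
        then have "p permutes A" by (intro permutes_superset[OF p1]) auto
        then show False using p2 by simp
      qed
      moreover have "p a \<in> insert a A" using permutes_in_image[OF p1, of a] by simp
      ultimately have "M a (p a) = 0" using z by auto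
      then show "of_int (sign p) * (\<Prod>i\<in>insert a A. M i (p i)) = 0"
        using fin a by simp
    qed
  qed
  also have "\<dots> = (\<Sum>p | p permutes A. M a a * (of_int (sign p) * (\<Prod>i\<in>A. M i (p i))))"
    by (intro sum.cong refl) (use fin a permutes_not_in in \<open>fastforce simp: mult_ac\<close>)
  finally show ?thesis by (simp add: detS_def sum_distrib_left)
qed

lemma detS_insert_col:
  assumes fin: "finite A" and a: "a \<notin> A" and z: "\<And>i. i \<in> A \<Longrightarrow> M i a = 0"
  shows "detS (insert a A) M = M a a * detS A M"
  using detS_insert_row[of A a "\<lambda>i j. M j i"] assms
    detS_transpose[of "insert a A" M] detS_transpose[of A M] by simp

lemma detS_union_unit_rows:
  assumes "finite A" "finite B" "A \<inter> B = {}"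
    and "\<And>i j. i \<in> B \<Longrightarrow> j \<in> A \<union> B \<Longrightarrow> i \<noteq> j \<Longrightarrow> M i j = 0"
  shows "detS (A \<union> B) M = (\<Prod>i\<in>B. M i i) * detS A M"
  using assms(2,1,3,4)
proof (induction B rule: finite_induct)
  case (insert b B)
  have "detS (insert b (A \<union> B)) M = M b b * detS (A \<union> B) M"
    by (rule detS_insert_row) (use insert in auto)
  also have "detS (A \<union> B) M = (\<Prod>i\<in>B. M i i) * detS A M"
    by (rule insert.IH) (use insert in auto)
  finally show ?case using insert by simp
qed simp

lemma detS_union_unit_cols:
  assumes "finite A" "finite B" "A \<inter> B = {}"
    and "\<And>i j. i \<in> B \<Longrightarrow> j \<in> A \<union> B \<Longrightarrow> i \<noteq> j \<Longrightarrow> M j i = 0"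
  shows "detS (A \<union> B) M = (\<Prod>i\<in>B. M i i) * detS A M"
  using detS_union_unit_rows[of A B "\<lambda>i j. M j i"] assms
    detS_transpose[of "A \<union> B" M] detS_transpose[of A M] by simp

lemma detS_diagonal:
  assumes "finite A" "\<And>i j. i \<in> A \<Longrightarrow> j \<in> A \<Longrightarrow> i \<noteq> j \<Longrightarrow> M i j = 0"
  shows "detS A M = (\<Prod>i\<in>A. M i i)"
  using detS_union_unit_rows[of "{}" A M] assms by simp

lemma detS_change_rows:
  assumes "finite I" "A \<subseteq> I"
    and "\<And>i j. i \<in> A \<Longrightarrow> j \<in> I \<Longrightarrow> M' i j = (\<Sum>l\<in>A. P i l * M l j)"
    and "\<And>i j. i \<in> I - A \<Longrightarrow> j \<in> I \<Longrightarrow> M' i j = M i j"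
  shows "detS I M' = detS A P * detS I M"
proof -
  have finA: "finite A" using assms(1,2) finite_subset by blast
  \<comment> \<open>Completing the transition matrix by the identity on \<open>I - A\<close> makes
    the change of rows a single matrix product.\<close>
  let ?P = "\<lambda>i l. if i \<in> A then (if l \<in> A then P i l else 0) else (if i = l then 1 else 0)"
  have "detS I M' = detS I (\<lambda>i j. \<Sum>l\<in>I. ?P i l * M l j)"
  proof (rule detS_cong)
    fix i j assume i: "i \<in> I" and j: "j \<in> I"
    show "M' i j = (\<Sum>l\<in>I. ?P i l * M l j)"
    proof (cases "i \<in> A")
      case True
      have "(\<Sum>l\<in>I. ?P i l * M l j) = (\<Sum>l\<in>A. ?P i l * M l j)"
        by (rule sum.mono_neutral_right) (use assms(1,2) True in auto)
      with True show ?thesis using assms(3) j by simp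
    next
      case False
      have "(\<Sum>l\<in>I. ?P i l * M l j) = (\<Sum>l\<in>I. if i = l then M l j else 0)"
        using False by (intro sum.cong) auto
      with False show ?thesis using assms(1,4) i j by simp
    qed
  qed
  also have "\<dots> = detS I ?P * detS I M" by (rule detS_mult) fact
  also have "detS I ?P = detS A ?P"
    using detS_union_unit_rows[of A "I - A" ?P] finA assms(1,2)
    by (simp add: Un_absorb1 Un_commute)
  also have "\<dots> = detS A P" by (rule detS_cong) simp
  finally show ?thesis .
qed

lemma detS_change_cols:
  assumes "finite I" "A \<subseteq> I"
    and "\<And>i j. i \<in> I \<Longrightarrow> j \<in> A \<Longrightarrow> M' i j = (\<Sum>l\<in>A. P l j * M i l)"
    and "\<And>i j. i \<in> I \<Longrightarrow> j \<in> I - A \<Longrightarrow> M' i j = M i j"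
  shows "detS I M' = detS A P * detS I M"
proof -
  have "finite A" using assms(1,2) finite_subset by blast
  then show ?thesis
    using detS_change_rows[of I A "\<lambda>i j. M' j i" "\<lambda>i j. P j i" "\<lambda>i j. M j i"] assms
      detS_transpose[of I M'] detS_transpose[of I M] detS_transpose[of A P] by simp
qed

text \<open>Exchanging the rows \<open>x\<close> and \<open>t\<close> brings \<open>M t x\<close>
  and \<open>M x t\<close> to the diagonal, where column \<open>x\<close> and then row
  \<open>t\<close> are otherwise zero. The exchange accounts for the minus sign.\<close>

lemma detS_hyperbolic_pair:
  assumes fin: "finite A" and xt: "x \<notin> A" "t \<notin> A" "x \<noteq> t"
    and "M x x = 0" "\<And>j. j \<in> A \<Longrightarrow> M x j = 0" "\<And>i. i \<in> A \<Longrightarrow> M i x = 0"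
  shows "detS (insert x (insert t A)) M = - (M x t * M t x) * detS A M"
proof -
  let ?s = "Transposition.transpose x t"
  let ?N = "\<lambda>i j. M (?s i) j"
  have s: "?s i = i" if "i \<in> A" for i
    using that xt by (metis transpose_apply_other)
  have "detS (insert x (insert t A)) ?N = ?N x x * detS (insert t A) ?N"
    by (rule detS_insert_col) (use assms s in auto)
  also have "detS (insert t A) ?N = ?N t t * detS A ?N"
    by (rule detS_insert_row) (use assms s in auto)
  also have "detS A ?N = detS A M" by (rule detS_cong) (simp add: s)
  also have "detS (insert x (insert t A)) ?N = - detS (insert x (insert t A)) M"
    by (rule detS_swap_rows) (use assms in auto)
  finally show ?thesis by (simp add: algebra_simps)
qed

text \<open>Each pair contributes -(1)(-1) = 1. The entries among the \<open>t\<close> and between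
  the \<open>t\<close> and \<open>A\<close> are free, which is what makes the corner of a bordered
  matrix immaterial.\<close>

lemma detS_hyperbolic_pairs:
  assumes "finite J" "finite A" "inj_on x J" "inj_on t J"
    and "x ` J \<inter> t ` J = {}" "x ` J \<inter> A = {}" "t ` J \<inter> A = {}"
    and "\<And>i j. i \<in> J \<Longrightarrow> j \<in> J \<Longrightarrow> M (x i) (x j) = 0"
    and "\<And>i a. i \<in> J \<Longrightarrow> a \<in> A \<Longrightarrow> M (x i) a = 0"
    and "\<And>i a. i \<in> J \<Longrightarrow> a \<in> A \<Longrightarrow> M a (x i) = 0"
    and "\<And>i j. i \<in> J \<Longrightarrow> j \<in> J \<Longrightarrow> M (x i) (t j) = (if i = j then 1 else 0)"
    and "\<And>i j. i \<in> J \<Longrightarrow> j \<in> J \<Longrightarrow> M (t i) (x j) = (if i = j then -1 else 0)"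
  shows "detS (x ` J \<union> t ` J \<union> A) M = detS A M"
  using assms(1,3-)
proof (induction J rule: finite_induct)
  case (insert b J)
  have "detS (insert (x b) (insert (t b) (x ` J \<union> t ` J \<union> A))) M
      = - (M (x b) (t b) * M (t b) (x b)) * detS (x ` J \<union> t ` J \<union> A) M"
  proof (rule detS_hyperbolic_pair)
    show "finite (x ` J \<union> t ` J \<union> A)" using insert(1) assms(2) by simp
    show "x b \<notin> x ` J \<union> t ` J \<union> A" "t b \<notin> x ` J \<union> t ` J \<union> A" "x b \<noteq> t b"
      using insert(2,4-8) by (auto simp: inj_on_def)
    show "M (x b) (x b) = 0" using insert.prems by simp
    show "M (x b) j = 0" if "j \<in> x ` J \<union> t ` J \<union> A" for j
      using that insert(2) insert.prems by auto
    show "M i (x b) = 0" if "i \<in> x ` J \<union> t ` J \<union> A" for i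
      using that insert(2) insert.prems by auto
  qed
  also have "detS (x ` J \<union> t ` J \<union> A) M = detS A M"
    by (rule insert.IH) (use insert.prems in auto)
  finally show ?case using insert.prems by (simp add: insert_commute)
qed simp

section \<open>Ordered bases\<close>

lemma sum_image_scaleR:
  assumes "inj_on a {..<k::nat}"
  shows "(\<Sum>v\<in>a ` {..<k}. u v *\<^sub>R v) = (\<Sum>i<k. u (a i) *\<^sub>R a i)"
  using assms by (simp add: sum.reindex)

lemma is_basis_of_coords:
  assumes "is_basis_of L k a" "v \<in> L"
  obtains p where "v = (\<Sum>i<k. p i *\<^sub>R a i)"
proof -
  have "v \<in> span (a ` {..<k})" using assms by (simp add: is_basis_of_def)
  then obtain u where "v = (\<Sum>x\<in>a ` {..<k}. u x *\<^sub>R x)"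
    by (auto simp: span_finite)
  then have "v = (\<Sum>i<k. u (a i) *\<^sub>R a i)"
    using assms sum_image_scaleR by (metis is_basis_of_def)
  then show thesis by (rule that)
qed

lemma is_basis_of_coeff_zero:
  assumes "is_basis_of L k a" "(\<Sum>i<k. p i *\<^sub>R a i) = 0" "i < k"
  shows "p i = 0"
proof -
  have inj: "inj_on a {..<k}" and ind: "independent (a ` {..<k})"
    using assms by (auto simp: is_basis_of_def)
  let ?u = "\<lambda>v. p (the_inv_into {..<k} a v)"
  have "(\<Sum>v\<in>a ` {..<k}. ?u v *\<^sub>R v) = (\<Sum>i<k. p i *\<^sub>R a i)"
    by (subst sum_image_scaleR[OF inj]) (simp add: the_inv_into_f_f[OF inj])
  then have "?u (a i) = 0"
    using ind assms(2,3) dependent_finite[of "a ` {..<k}"] by auto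
  then show ?thesis using assms(3) by (simp add: the_inv_into_f_f[OF inj])
qed

lemma is_basis_of_coeff_unique:
  assumes "is_basis_of L k a" "(\<Sum>i<k. p i *\<^sub>R a i) = (\<Sum>i<k. q i *\<^sub>R a i)" "i < k"
  shows "p i = q i"
proof -
  have "(\<Sum>i<k. (p i - q i) *\<^sub>R a i) = 0"
    using assms(2) by (simp add: scaleR_diff_left sum_subtractf)
  from is_basis_of_coeff_zero[OF assms(1) this assms(3)] show ?thesis by simp
qed

lemma is_basis_of_mem: "is_basis_of L k a \<Longrightarrow> i < k \<Longrightarrow> a i \<in> L"
  unfolding is_basis_of_def by (metis imageI lessThan_iff span_base)

lemma is_basis_of_subspace: "is_basis_of L k a \<Longrightarrow> subspace L"
  unfolding is_basis_of_def by auto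

lemma is_basis_of_dim: "is_basis_of L k a \<Longrightarrow> dim L = k"
  unfolding is_basis_of_def by (metis card_image card_lessThan dim_span dim_eq_card_independent)

lemma is_basis_of_cong:
  assumes "\<And>i. i < k \<Longrightarrow> a i = b i"
  shows "is_basis_of L k a \<longleftrightarrow> is_basis_of L k b"
proof -
  have "a ` {..<k} = b ` {..<k}" "inj_on a {..<k} \<longleftrightarrow> inj_on b {..<k}"
    using assms by (auto simp: inj_on_def image_iff)
  then show ?thesis by (simp add: is_basis_of_def)
qed

lemma is_basis_ofI:
  fixes a :: "nat \<Rightarrow> 'a::euclidean_space"
  assumes L: "subspace L" and mem: "\<And>i. i < k \<Longrightarrow> a i \<in> L" and dim: "dim L \<le> k"
    and ind: "\<And>p. (\<Sum>i<k. p i *\<^sub>R a i) = 0 \<Longrightarrow> \<forall>i<k. p i = 0"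
  shows "is_basis_of L k a"
proof -
  have inj: "inj_on a {..<k}"
  proof (rule inj_onI)
    fix i j assume ij: "i \<in> {..<k}" "j \<in> {..<k}" "a i = a j"
    show "i = j"
    proof (rule ccontr)
      assume ne: "i \<noteq> j"
      let ?p = "\<lambda>l. if l = i then 1 else if l = j then -1 else (0::real)"
      have "(\<Sum>l<k. ?p l *\<^sub>R a l) = (\<Sum>l\<in>{i, j}. ?p l *\<^sub>R a l)"
        by (rule sum.mono_neutral_right) (use ij in auto)
      also have "\<dots> = 0" using ij ne by simp
      finally have "?p i = 0" using ind[of ?p] ij(1) by blast
      then show False by simp
    qed
  qed
  have indep: "independent (a ` {..<k})"
    unfolding independent_explicit
  proof (intro conjI allI impI ballI)
    fix u v assume "(\<Sum>v\<in>a ` {..<k}. u v *\<^sub>R v) = 0" "v \<in> a ` {..<k}"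
    then show "u v = (0::real)"
      using ind[of "\<lambda>i. u (a i)"] sum_image_scaleR[OF inj, of u] by auto
  qed simp
  have "L \<subseteq> span (a ` {..<k})"
    by (rule card_ge_dim_independent) (use mem indep dim inj in \<open>auto simp: card_image\<close>)
  moreover have "span (a ` {..<k}) \<subseteq> L"
    by (rule span_minimal) (use mem L in auto)
  ultimately show ?thesis using inj indep by (auto simp: is_basis_of_def)
qed

lemma is_basis_of_exists:
  fixes L :: "'a::euclidean_space set"
  assumes "subspace L"
  obtains a where "is_basis_of L (dim L) a"
proof -
  obtain B where B: "B \<subseteq> L" "independent B" "L \<subseteq> span B" "card B = dim L"
    by (rule basis_exists)
  obtain a where "bij_betw a {..<dim L} B"
    using ex_bij_betw_nat_finite[of B] B(2,4) independent_imp_finite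
    by (metis lessThan_atLeast0)
  moreover have "span B = L" using B assms by (metis span_minimal subset_antisym)
  ultimately have "is_basis_of L (dim L) a"
    using B by (auto simp: is_basis_of_def bij_betw_def)
  then show thesis by (rule that)
qed

lemma is_basis_of_extend:
  fixes L :: "'a::euclidean_space set"
  assumes c: "is_basis_of K m c" and "K \<subseteq> L" and L: "subspace L"
  obtains a' where "is_basis_of L (dim L) (concat_seq m c a')"
proof -
  let ?C = "c ` {..<m}"
  have C: "independent ?C" "?C \<subseteq> L" "inj_on c {..<m}" "span ?C = K"
    using c assms(2) is_basis_of_mem[OF c] by (auto simp: is_basis_of_def)
  obtain B where B: "?C \<subseteq> B" "B \<subseteq> L" "independent B" "L \<subseteq> span B"
    using maximal_independent_subset_extend[OF C(2,1)] by blast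
  have fB: "finite B" using B(3) independent_imp_finite by blast
  have cB: "card B = dim L" using B by (simp add: basis_card_eq_dim)
  have cBC: "card (B - ?C) = dim L - m"
    using B(1) cB C(3) by (simp add: card_Diff_subset card_image)
  have mle: "m \<le> dim L"
    using card_mono[OF fB B(1)] cB C(3) by (simp add: card_image)
  obtain a' where a': "bij_betw a' {..<dim L - m} (B - ?C)"
    using ex_bij_betw_nat_finite[of "B - ?C"] fB cBC by (metis finite_Diff lessThan_atLeast0)
  let ?s = "concat_seq m c a'"
  have im: "?s ` {..<dim L} = B"
  proof -
    have "{..<dim L} = {..<m} \<union> (+) m ` {..<dim L - m}"
    proof (intro equalityI subsetI)
      fix x assume "x \<in> {..<dim L}"
      then show "x \<in> {..<m} \<union> (+) m ` {..<dim L - m}"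
        by (cases "x < m") (auto intro!: image_eqI[of _ _ "x - m"])
    qed (use mle in auto)
    then have "?s ` {..<dim L} = ?s ` {..<m} \<union> ?s ` (+) m ` {..<dim L - m}"
      by (simp add: image_Un)
    also have "?s ` {..<m} = ?C" by (auto simp: concat_seq_def)
    also have "?s ` (+) m ` {..<dim L - m} = a' ` {..<dim L - m}"
      unfolding image_image by (simp add: concat_seq_def)
    also have "\<dots> = B - ?C" using a' by (simp add: bij_betw_def)
    finally show ?thesis using B(1) by blast
  qed
  moreover have "inj_on ?s {..<dim L}"
    by (rule eq_card_imp_inj_on) (simp_all add: im cB)
  moreover have "span B = L" using B(2,4) L by (metis span_minimal subset_antisym)
  ultimately have "is_basis_of L (dim L) ?s" using B(3) by (simp add: is_basis_of_def)
  then show thesis by (rule that)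
qed

lemma is_basis_of_transition:
  assumes a: "is_basis_of L k a" and b: "is_basis_of L k b"
  obtains P Q where "\<And>j. j < k \<Longrightarrow> b j = (\<Sum>i<k. P i j *\<^sub>R a i)"
    and "\<And>j. j < k \<Longrightarrow> a j = (\<Sum>i<k. Q i j *\<^sub>R b i)"
    and "\<And>i j. i < k \<Longrightarrow> j < k \<Longrightarrow> (\<Sum>l<k. Q i l * P l j) = (if i = j then 1 else 0)"
    and "detS {..<k} Q * detS {..<k} P = 1"
proof -
  have "\<forall>j\<in>{..<k}. \<exists>p. b j = (\<Sum>i<k. p i *\<^sub>R a i)"
    using is_basis_of_coords[OF a] is_basis_of_mem[OF b] by (metis lessThan_iff)
  then obtain P where P: "\<And>j. j < k \<Longrightarrow> b j = (\<Sum>i<k. P j i *\<^sub>R a i)"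
    unfolding bchoice_iff by auto
  have "\<forall>j\<in>{..<k}. \<exists>p. a j = (\<Sum>i<k. p i *\<^sub>R b i)"
    using is_basis_of_coords[OF b] is_basis_of_mem[OF a] by (metis lessThan_iff)
  then obtain Q where Q: "\<And>j. j < k \<Longrightarrow> a j = (\<Sum>i<k. Q j i *\<^sub>R b i)"
    unfolding bchoice_iff by auto
  have QP: "(\<Sum>l<k. Q l i * P j l) = (if i = j then 1 else 0)" if "i < k" "j < k" for i j
  proof (rule is_basis_of_coeff_unique[OF b _ that(1)])
    have "(\<Sum>i<k. (\<Sum>l<k. Q l i * P j l) *\<^sub>R b i) = (\<Sum>l<k. P j l *\<^sub>R (\<Sum>i<k. Q l i *\<^sub>R b i))"
      unfolding scaleR_sum_left scaleR_sum_right
      by (subst sum.swap) (simp add: mult.commute)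
    also have "\<dots> = (\<Sum>l<k. P j l *\<^sub>R a l)" using Q by simp
    also have "\<dots> = b j" using P that(2) by simp
    also have "\<dots> = (\<Sum>i<k. (if i = j then 1 else 0) *\<^sub>R b i)"
      using that(2) by (simp add: if_distrib[of "\<lambda>x. x *\<^sub>R _"] cong: if_cong)
    finally show "(\<Sum>i<k. (\<Sum>l<k. Q l i * P j l) *\<^sub>R b i) =
      (\<Sum>i<k. (if i = j then 1 else 0) *\<^sub>R b i)" .
  qed
  have "detS {..<k} (\<lambda>i j. \<Sum>l<k. Q l i * P j l) = detS {..<k} (\<lambda>i j. Q j i) * detS {..<k} (\<lambda>i j. P j i)"
    by (rule detS_mult) simp
  moreover have "detS {..<k} (\<lambda>i j. \<Sum>l<k. Q l i * P j l) = 1"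
    by (subst detS_diagonal) (simp_all add: QP)
  ultimately show thesis using that[of "\<lambda>i j. P j i" "\<lambda>i j. Q j i"] P Q QP by simp
qed

section \<open>Orientations\<close>

lemma same_orient_iff:
  assumes a: "is_basis_of L k a" and P: "\<And>j. j < k \<Longrightarrow> b j = (\<Sum>i<k. P i j *\<^sub>R a i)"
  shows "same_orient k a b \<longleftrightarrow> detS {..<k} P > 0"
proof
  assume "same_orient k a b"
  then obtain Q where Q: "\<And>j. j < k \<Longrightarrow> b j = (\<Sum>i<k. Q i j *\<^sub>R a i)" "detS {..<k} Q > 0"
    by (auto simp: same_orient_def det_n_eq_detS)
  have "detS {..<k} P = detS {..<k} Q"
  proof (rule detS_cong)
    fix i j assume "i \<in> {..<k}" "j \<in> {..<k}"
    then show "P i j = Q i j"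
      using is_basis_of_coeff_unique[OF a, of "\<lambda>i. P i j" "\<lambda>i. Q i j" i] P[of j] Q(1)[of j] by simp
  qed
  then show "detS {..<k} P > 0" using Q by simp
qed (use P in \<open>auto simp: same_orient_def det_n_eq_detS\<close>)

lemma sgn_int_mult: "sgn_int (x * y) = sgn_int x * sgn_int y"
  by (auto simp: sgn_int_def zero_less_mult_iff mult_less_0_iff)

lemma sgn_int_pos [simp]: "x > 0 \<Longrightarrow> sgn_int x = 1"
  by (simp add: sgn_int_def)

text \<open>A proper inclusion leaves at least one vector after \<open>c\<close>; negating it
  reverses the orientation without touching the basis of \<open>K\<close>.\<close>

lemma oriented_basis_extend:
  fixes L :: "'a::euclidean_space set"
  assumes a: "is_basis_of L k a" and c: "is_basis_of K m c" and "K \<subset> L"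
  obtains a' where "is_basis_of L k (concat_seq m c a')" "same_orient k a (concat_seq m c a')"
proof -
  have L: "subspace L" "dim L = k" using a is_basis_of_subspace is_basis_of_dim by auto
  obtain a' where a': "is_basis_of L k (concat_seq m c a')"
    using is_basis_of_extend[OF c _ L(1)] assms(3) L(2) by (metis psubset_imp_subset)
  have mk: "m < k"
  proof (rule ccontr)
    assume "\<not> m < k"
    then have "dim L \<le> dim K" using L(2) is_basis_of_dim[OF c] by simp
    then have "K = L" using assms(3) is_basis_of_subspace[OF c] L(1) subspace_dim_equal by blast
    then show False using assms(3) by simp
  qed
  obtain P Q where P: "\<And>j. j < k \<Longrightarrow> concat_seq m c a' j = (\<Sum>i<k. P i j *\<^sub>R a i)"
    and PQ: "detS {..<k} Q * detS {..<k} P = 1"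
    by (rule is_basis_of_transition[OF a a']) blast
  show thesis
  proof (cases "detS {..<k} P > 0")
    case True
    then have "same_orient k a (concat_seq m c a')"
      using same_orient_iff[OF a, of "concat_seq m c a'" P] P by simp
    then show thesis using that[OF a'] by blast
  next
    case False
    then have neg: "detS {..<k} P < 0" using PQ by (metis mult_zero_right not_less_iff_gr_or_eq zero_neq_one)
    \<comment> \<open>The first lift sits at position \<open>m\<close> of the concatenation, so its
      negation changes the sign of just that column of the transition matrix.\<close>
    let ?a = "concat_seq m c (a'(0 := - a' 0))"
    let ?e = "\<lambda>j. if j = m then -1 else (1::real)"
    have eq: "?a j = ?e j *\<^sub>R concat_seq m c a' j" for j
      by (auto simp: concat_seq_def)
    let ?P = "\<lambda>i j. ?e j * P i j"
    have P': "?a j = (\<Sum>i<k. ?P i j *\<^sub>R a i)" if "j < k" for j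
      unfolding eq P[OF that] scaleR_sum_right by simp
    have "detS {..<k} ?P = detS {m} (\<lambda>i j. -1) * detS {..<k} P"
      by (rule detS_change_cols) (use mk in auto)
    also have "detS {m} (\<lambda>i j. -1) = -1" by (subst detS_diagonal) auto
    finally have "detS {..<k} ?P > 0" using neg by simp
    then have so: "same_orient k a ?a" 
      using same_orient_iff[OF a, of ?a ?P] P' by simp
    have "is_basis_of L k ?a"
    proof (rule is_basis_ofI[OF L(1)])
      show "?a i \<in> L" if "i < k" for i
        unfolding eq using is_basis_of_mem[OF a' that] L(1) by (simp add: subspace_mul subspace_neg)
      show "dim L \<le> k" using L(2) by simp
      fix p assume "(\<Sum>i<k. p i *\<^sub>R ?a i) = 0"
      then have "(\<Sum>i<k. (p i * ?e i) *\<^sub>R concat_seq m c a' i) = 0"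
        unfolding eq by simp
      then have "p i * ?e i = 0" if "i < k" for i
        using is_basis_of_coeff_zero[OF a', of "\<lambda>i. p i * ?e i"] that by blast
      then show "\<forall>i<k. p i = 0" by (metis mult_eq_0_iff neg_equal_0_iff_equal one_neq_zero)
    qed
    then show thesis using that so by blast
  qed
qed

section \<open>The sign of a pair of oriented lagrangians as a bordered determinant\<close>

lemma omega_bilinear: "bounded_bilinear (omega :: 'g::finite symvec \<Rightarrow> _)"
proof -
  have "bilinear (omega :: 'g::finite symvec \<Rightarrow> _)"
    unfolding bilinear_def
    by (intro conjI allI linearI)
      (simp_all add: omega_def algebra_simps sum.distrib sum_subtractf sum_distrib_left)
  then show ?thesis by (simp add: bilinear_conv_bounded_bilinear)
qed

interpretation omega: bounded_bilinear omega
  by (rule omega_bilinear)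

lemma omega_swap: "omega y x = - omega x y"
  by (simp add: omega_def sum_negf[symmetric] algebra_simps)

text \<open>The corner is a parameter rather than \<open>omega (t i) (t j)\<close>, so that it can
  later be chosen to complete a Gram matrix.\<close>

fun bordered :: "(nat \<Rightarrow> 'g::finite symvec) \<Rightarrow> (nat \<Rightarrow> 'g symvec) \<Rightarrow> (nat \<Rightarrow> 'g symvec)
    \<Rightarrow> (nat \<Rightarrow> nat \<Rightarrow> real) \<Rightarrow> nat + nat \<Rightarrow> nat + nat \<Rightarrow> real" where
  "bordered a b t C (Inl i) (Inl j) = omega (a i) (b j)"
| "bordered a b t C (Inl i) (Inr j) = omega (a i) (t j)"
| "bordered a b t C (Inr i) (Inl j) = omega (t i) (b j)"
| "bordered a b t C (Inr i) (Inr j) = C i j"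

lemma detS_Inl: "finite A \<Longrightarrow> detS (Inl ` A) M = detS A (\<lambda>i j. M (Inl i) (Inl j))"
  by (rule detS_reindex) (auto simp: bij_betw_def)

lemma detS_Inr: "finite A \<Longrightarrow> detS (Inr ` A) M = detS A (\<lambda>i j. M (Inr i) (Inr j))"
  by (rule detS_reindex) (auto simp: bij_betw_def)

lemma sum_Inl: "(\<Sum>x\<in>Inl ` A. g x) = (\<Sum>i\<in>A. g (Inl i))"
  by (simp add: sum.reindex)

lemma sum_Inr: "(\<Sum>x\<in>Inr ` A. g x) = (\<Sum>i\<in>A. g (Inr i))"
  by (simp add: sum.reindex)

lemma detS_bordered_change_left:
  assumes "\<And>j. j < k \<Longrightarrow> a' j = (\<Sum>i<k. P i j *\<^sub>R a i)"
  shows "detS ({..<k} <+> {..<m}) (bordered a' b t C) =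
    detS {..<k} P * detS ({..<k} <+> {..<m}) (bordered a b t C)"
proof -
  let ?P = "\<lambda>x y. P (projl y) (projl x)"
  have "detS ({..<k} <+> {..<m}) (bordered a' b t C) =
     detS (Inl ` {..<k} :: (nat + nat) set) ?P * detS ({..<k} <+> {..<m}) (bordered a b t C)"
    by (rule detS_change_rows)
       (auto simp: Plus_def sum_Inl assms omega.sum_left omega.scaleR_left)
  also have "detS (Inl ` {..<k} :: (nat + nat) set) ?P = detS {..<k} P"
    using detS_transpose[of "{..<k}" P] by (simp add: detS_Inl)
  finally show ?thesis .
qed

lemma detS_bordered_change_right:
  assumes "\<And>j. j < k \<Longrightarrow> b' j = (\<Sum>i<k. P i j *\<^sub>R b i)"
  shows "detS ({..<k} <+> {..<m}) (bordered a b' t C) =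
    detS {..<k} P * detS ({..<k} <+> {..<m}) (bordered a b t C)"
proof -
  let ?P = "\<lambda>x y. P (projl x) (projl y)"
  have "detS ({..<k} <+> {..<m}) (bordered a b' t C) =
     detS (Inl ` {..<k} :: (nat + nat) set) ?P * detS ({..<k} <+> {..<m}) (bordered a b t C)"
    by (rule detS_change_cols)
       (auto simp: Plus_def sum_Inl assms omega.sum_right omega.scaleR_right)
  also have "detS (Inl ` {..<k} :: (nat + nat) set) ?P = detS {..<k} P"
    by (simp add: detS_Inl)
  finally show ?thesis .
qed

text \<open>Bordering by vectors dual to the intersection of the lagrangians gives a matrix that is
  nonsingular without passing to quotients; its sign does not depend on the corner \<open>C\<close>.\<close>

lemma sgn_bordered_adapted:
  assumes mk: "m \<le> k"
    and z1: "\<And>i j. i < m \<Longrightarrow> j < k \<Longrightarrow> omega (a i) (b j) = 0"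
    and z2: "\<And>i j. i < k \<Longrightarrow> j < m \<Longrightarrow> omega (a i) (b j) = 0"
    and ab: "\<And>i. i < m \<Longrightarrow> a i = b i"
    and S: "\<And>i j. i < m \<Longrightarrow> j < m \<Longrightarrow> (\<Sum>l<m. omega (a i) (t l) * S l j) = (if i = j then 1 else 0)"
  shows "sgn_int (detS ({..<k} <+> {..<m}) (bordered a b t C)) =
    sgn_int (detS {m..<k} (\<lambda>i j. omega (a i) (b j)))"
proof -
  let ?I = "{..<k} <+> {..<m}" and ?T = "Inr ` {..<m} :: (nat + nat) set"
  let ?M = "bordered a b t C"
  \<comment> \<open>The border is multiplied by \<open>S\<close> in the columns and then in the
    rows. This congruence costs the square of \<open>detS {..<m} S\<close> and makes the border dual
    to the common vectors \<open>a i = b i\<close>, \<open>i < m\<close>.\<close>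
  define M1 where "M1 u v = (case v of Inl j \<Rightarrow> ?M u v | Inr j \<Rightarrow> \<Sum>l<m. S l j * ?M u (Inr l))" for u v
  define M2 where "M2 u v = (case u of Inl j \<Rightarrow> M1 u v | Inr j \<Rightarrow> \<Sum>l<m. S l j * M1 (Inr l) v)" for u v
  have "detS ?I M1 = detS ?T (\<lambda>x y. S (projr x) (projr y)) * detS ?I ?M"
    by (rule detS_change_cols) (auto simp: Plus_def sum_Inr M1_def)
  then have d1: "detS ?I M1 = detS {..<m} S * detS ?I ?M" by (simp add: detS_Inr)
  have "detS ?I M2 = detS ?T (\<lambda>x y. S (projr y) (projr x)) * detS ?I M1"
    by (rule detS_change_rows) (auto simp: Plus_def sum_Inr M2_def)
  then have d2: "detS ?I M2 = detS {..<m} S * detS ?I M1"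
    using detS_transpose[of "{..<m}" S] by (simp add: detS_Inr)
  have "detS {..<m} (\<lambda>i j. omega (a i) (t j)) * detS {..<m} S = 
     detS {..<m} (\<lambda>i j. \<Sum>l<m. omega (a i) (t l) * S l j)"
    by (rule detS_mult[symmetric]) simp
  also have "\<dots> = 1" by (subst detS_diagonal) (simp_all add: S)
  finally have S0: "detS {..<m} S \<noteq> 0" by auto
  have "?I = Inl ` {..<m} \<union> ?T \<union> Inl ` {m..<k}" using mk by (auto simp: Plus_def image_iff)
  \<comment> \<open>Each common vector and its dual form a pair with entries 1 and, by antisymmetry
    of \<open>omega\<close>, -1. The block that remains is the matrix on the lifts of the
    quotients.\<close>
  moreover have "detS (Inl ` {..<m} \<union> ?T \<union> Inl ` {m..<k}) M2 = detS (Inl ` {m..<k}) M2"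
  proof (rule detS_hyperbolic_pairs)
    show "M2 (Inl i) (Inr j) = (if i = j then 1 else 0)" if "i \<in> {..<m}" "j \<in> {..<m}" for i j
      using S[of i j] that by (simp add: M2_def M1_def mult.commute)
    show "M2 (Inr i) (Inl j) = (if i = j then -1 else 0)" if "i \<in> {..<m}" "j \<in> {..<m}" for i j
    proof -
      have "M2 (Inr i) (Inl j) = (\<Sum>l<m. S l i * omega (t l) (a j))"
        using that ab by (simp add: M2_def M1_def)
      also have "\<dots> = - (\<Sum>l<m. omega (a j) (t l) * S l i)"
        unfolding sum_negf[symmetric]
        by (intro sum.cong refl) (metis mult.commute mult_minus_left omega_swap)
      finally show ?thesis using S[of j i] that by auto
    qed
  qed (use z1 z2 mk in \<open>auto simp: M2_def M1_def\<close>)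
  moreover have "detS (Inl ` {m..<k}) M2 = detS {m..<k} (\<lambda>i j. omega (a i) (b j))"
    unfolding detS_Inl[OF finite_atLeastLessThan] by (rule detS_cong) (simp add: M2_def M1_def)
  ultimately have "detS {m..<k} (\<lambda>i j. omega (a i) (b j)) = (detS {..<m} S * detS {..<m} S) * detS ?I ?M"
    using d1 d2 by simp
  moreover have "detS {..<m} S * detS {..<m} S > 0"
    using S0 by (auto simp: zero_less_mult_iff linorder_neq_iff)
  ultimately show ?thesis by (simp add: sgn_int_def zero_less_mult_iff mult_less_0_iff)
qed

text \<open>The border is tied to one basis \<open>c0\<close> of the intersection, while the choice
  inside \<open>epsilon\<close> may return another basis \<open>c\<close>. The pairing of
  \<open>c\<close> with \<open>t\<close> is then a transition matrix, whose inverse \<open>Q\<close>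
  supplies the \<open>S\<close> that restores duality.\<close>

lemma sgn_bordered_concat:
  fixes a b :: "nat \<Rightarrow> 'g::finite symvec"
  assumes iso1: "\<And>x y. x \<in> L1 \<Longrightarrow> y \<in> L1 \<Longrightarrow> omega x y = 0"
    and iso2: "\<And>x y. x \<in> L2 \<Longrightarrow> y \<in> L2 \<Longrightarrow> omega x y = 0"
    and c0: "is_basis_of (L1 \<inter> L2) m c0"
    and t: "\<And>i j. i < m \<Longrightarrow> j < m \<Longrightarrow> omega (c0 i) (t j) = (if i = j then 1 else 0)"
    and c: "is_basis_of (L1 \<inter> L2) m c"
    and a': "is_basis_of L1 k (concat_seq m c a')" and b': "is_basis_of L2 k (concat_seq m c b')"
  shows "sgn_int (detS ({..<k} <+> {..<m}) (bordered (concat_seq m c a') (concat_seq m c b') t C)) =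
    sgn_int (det_n (k - m) (\<lambda>i j. omega (a' i) (b' j)))"
proof -
  let ?a = "concat_seq m c a'" and ?b = "concat_seq m c b'"
  obtain P Q where P: "\<And>j. j < m \<Longrightarrow> c j = (\<Sum>i<m. P i j *\<^sub>R c0 i)"
    and QP: "\<And>i j. i < m \<Longrightarrow> j < m \<Longrightarrow> (\<Sum>l<m. Q i l * P l j) = (if i = j then 1 else 0)"
    by (rule is_basis_of_transition[OF c0 c]) blast
  have ct: "omega (c i) (t l) = P l i" if "i < m" "l < m" for i l
  proof -
    have "omega (c i) (t l) = (\<Sum>j<m. P j i * (if j = l then 1 else 0))"
      using that t by (simp add: P omega.sum_left omega.scaleR_left)
    then show ?thesis using that by (simp add: if_distrib[of "(*) _"] cong: if_cong)
  qed
  have mk: "m \<le> k"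
    using dim_subset[of "L1 \<inter> L2" L1] is_basis_of_dim[OF c] is_basis_of_dim[OF a'] by simp
  have cL: "c i \<in> L1" "c i \<in> L2" if "i < m" for i using is_basis_of_mem[OF c that] by auto
  have "sgn_int (detS ({..<k} <+> {..<m}) (bordered ?a ?b t C)) =
    sgn_int (detS {m..<k} (\<lambda>i j. omega (?a i) (?b j)))"
  proof (rule sgn_bordered_adapted[OF mk, where S = "\<lambda>l j. Q j l"])
    show "omega (?a i) (?b j) = 0" if "i < m" "j < k" for i j
      using iso2[OF _ is_basis_of_mem[OF b' that(2)]] cL[OF that(1)] that by (simp add: concat_seq_def)
    show "omega (?a i) (?b j) = 0" if "i < k" "j < m" for i j
      using iso1[OF is_basis_of_mem[OF a' that(1)]] cL[OF that(2)] that by (simp add: concat_seq_def)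
    show "?a i = ?b i" if "i < m" for i using that by (simp add: concat_seq_def)
    show "(\<Sum>l<m. omega (?a i) (t l) * Q j l) = (if i = j then 1 else 0)" if "i < m" "j < m" for i j
      using QP[of j i] that by (auto simp: concat_seq_def ct mult.commute)
  qed
  also have "detS {m..<k} (\<lambda>i j. omega (?a i) (?b j)) =
      detS {..<k - m} (\<lambda>i j. omega (?a (i + m)) (?b (j + m)))"
  proof (rule detS_reindex)
    show "bij_betw (\<lambda>i. i + m) {..<k - m} {m..<k}"
      by (rule bij_betwI[where g = "\<lambda>i. i - m"]) auto
  qed simp
  also have "\<dots> = det_n (k - m) (\<lambda>i j. omega (a' i) (b' j))"
    unfolding det_n_eq_detS by (rule detS_cong) (simp add: concat_seq_def)
  finally show ?thesis .
qed

text \<open>Removes the case distinction and the choice from \<open>epsilon\<close>. A change of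
  either basis multiplies the bordered determinant by the transition determinant, so its sign
  depends only on orientations and may be evaluated in bases adapted to the intersection.\<close>

lemma epsilon_eq_sgn_bordered:
  fixes a b :: "nat \<Rightarrow> 'g::finite symvec"
  assumes a: "is_basis_of L1 k a" and b: "is_basis_of L2 k b"
    and iso1: "\<And>x y. x \<in> L1 \<Longrightarrow> y \<in> L1 \<Longrightarrow> omega x y = 0"
    and iso2: "\<And>x y. x \<in> L2 \<Longrightarrow> y \<in> L2 \<Longrightarrow> omega x y = 0"
    and c0: "is_basis_of (L1 \<inter> L2) m c0"
    and t: "\<And>i j. i < m \<Longrightarrow> j < m \<Longrightarrow> omega (c0 i) (t j) = (if i = j then 1 else 0)"
  shows "epsilon k a b = sgn_int (detS ({..<k} <+> {..<m}) (bordered a b t C))"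
proof -
  let ?I = "{..<k} <+> {..<m}"
  have sp: "span (a ` {..<k}) = L1" "span (b ` {..<k}) = L2"
    using a b by (auto simp: is_basis_of_def)
  have m: "dim (L1 \<inter> L2) = m" using is_basis_of_dim[OF c0] .
  have concat: "sgn_int (detS ?I (bordered (concat_seq m c a') (concat_seq m c b') t C)) =
      sgn_int (det_n (k - m) (\<lambda>i j. omega (a' i) (b' j)))"
    if "is_basis_of (L1 \<inter> L2) m c"
      "is_basis_of L1 k (concat_seq m c a')" "is_basis_of L2 k (concat_seq m c b')" for c a' b'
    by (rule sgn_bordered_concat[OF _ _ c0 _ that]) (use iso1 iso2 t in auto)
  consider "L1 \<inter> L2 = {0}" | "L1 \<inter> L2 \<noteq> {0}" "L1 = L2" | "L1 \<inter> L2 \<noteq> {0}" "L1 \<noteq> L2" by blast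
  then show ?thesis
  proof cases
    case 1
    then have "m = 0" using m by simp
    then have "detS ?I (bordered a b t C) = det_n k (\<lambda>i j. omega (a i) (b j))"
      by (simp add: Plus_def detS_Inl det_n_eq_detS)
    with 1 show ?thesis by (simp add: epsilon_def Let_def sp)
  next
    case 2
    then have mk: "m = k" using m is_basis_of_dim[OF a] by simp
    \<comment> \<open>With \<open>b\<close> in both places nothing is left outside the intersection,
      so the remaining determinant is empty and the sign is 1. Exchanging one \<open>b\<close> for
      \<open>a\<close> brings in the sign of the transition determinant, which is what
      \<open>same_orient\<close> tests.\<close>
    have b2: "is_basis_of (L1 \<inter> L2) m b" using b 2 mk by simp
    have cs: "concat_seq m b b j = b j" if "j < k" for j
      using that mk by (simp add: concat_seq_def)
    obtain P Q where P: "\<And>j. j < k \<Longrightarrow> b j = (\<Sum>i<k. P i j *\<^sub>R a i)"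
      and PQ: "detS {..<k} Q * detS {..<k} P = 1"
      by (rule is_basis_of_transition[OF a b[folded 2(2)]]) blast
    have b1: "is_basis_of L1 k (concat_seq m b b)" "is_basis_of L2 k (concat_seq m b b)"
      using is_basis_of_cong[of k "concat_seq m b b" b] cs b 2 by auto
    have "sgn_int (detS ?I (bordered (concat_seq m b b) (concat_seq m b b) t C)) = 1"
      using concat[OF b2 b1] mk by (simp add: det_n_eq_detS)
    moreover have "detS ?I (bordered (concat_seq m b b) (concat_seq m b b) t C) =
        detS ?I (bordered b b t C)"
      by (rule detS_cong) (auto simp: Plus_def cs)
    moreover have "detS ?I (bordered b b t C) = detS {..<k} P * detS ?I (bordered a b t C)"
      by (rule detS_bordered_change_left) (use P in simp)
    ultimately have "sgn_int (detS {..<k} P) * sgn_int (detS ?I (bordered a b t C)) = 1"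
      by (simp add: sgn_int_mult)
    moreover have "same_orient k a b \<longleftrightarrow> detS {..<k} P > 0"
      using same_orient_iff[OF a, of b P] P by blast
    ultimately show ?thesis using 2
      by (auto simp: epsilon_def Let_def sp sgn_int_def split: if_splits)
  next
    case 3
    have dims: "dim L1 = k" "dim L2 = k" using a b is_basis_of_dim by auto
    have ss: "subspace L1" "subspace L2" using a b is_basis_of_subspace by auto
    have ps: "L1 \<inter> L2 \<subset> L1" "L1 \<inter> L2 \<subset> L2"
      using subspace_dim_equal[OF ss] subspace_dim_equal[OF ss(2,1)] dims 3(2) by auto
    let ?R = "\<lambda>(c, a', b'). is_basis_of (L1 \<inter> L2) m c
                 \<and> is_basis_of L1 k (concat_seq m c a') \<and> same_orient k a (concat_seq m c a')
                 \<and> is_basis_of L2 k (concat_seq m c b') \<and> same_orient k b (concat_seq m c b')"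
    \<comment> \<open>The condition under \<open>SOME\<close> is satisfiable: both inclusions are
      proper, so \<open>c0\<close> extends to positively oriented bases on both sides.\<close>
    obtain a1 where "is_basis_of L1 k (concat_seq m c0 a1)" "same_orient k a (concat_seq m c0 a1)"
      by (rule oriented_basis_extend[OF a c0 ps(1)])
    moreover obtain b1 where "is_basis_of L2 k (concat_seq m c0 b1)" "same_orient k b (concat_seq m c0 b1)"
      by (rule oriented_basis_extend[OF b c0 ps(2)])
    ultimately have "?R (c0, a1, b1)" using c0 by simp
    then have R: "?R (SOME x. ?R x)" by (rule someI)
    obtain c a' b' where cab: "(SOME x. ?R x) = (c, a', b')" by (rule prod_cases3)
    have c: "is_basis_of (L1 \<inter> L2) m c"
      and a': "is_basis_of L1 k (concat_seq m c a')" "same_orient k a (concat_seq m c a')"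
      and b': "is_basis_of L2 k (concat_seq m c b')" "same_orient k b (concat_seq m c b')"
      using R unfolding cab by auto
    obtain PA where PA: "\<And>j. j < k \<Longrightarrow> concat_seq m c a' j = (\<Sum>i<k. PA i j *\<^sub>R a i)" "detS {..<k} PA > 0"
      using a'(2) by (auto simp: same_orient_def det_n_eq_detS)
    obtain PB where PB: "\<And>j. j < k \<Longrightarrow> concat_seq m c b' j = (\<Sum>i<k. PB i j *\<^sub>R b i)" "detS {..<k} PB > 0"
      using b'(2) by (auto simp: same_orient_def det_n_eq_detS)
    have "epsilon k a b = sgn_int (det_n (k - m) (\<lambda>i j. omega (a' i) (b' j)))"
      using 3 cab by (simp add: epsilon_def Let_def sp m)
    also have "\<dots> = sgn_int (detS ?I (bordered (concat_seq m c a') (concat_seq m c b') t C))"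
      using concat[OF c a'(1) b'(1)] by simp
    also have "detS ?I (bordered (concat_seq m c a') (concat_seq m c b') t C) =
        detS {..<k} PA * (detS {..<k} PB * detS ?I (bordered a b t C))"
      by (simp only: detS_bordered_change_left[of k "concat_seq m c a'" PA a, OF PA(1)]
        detS_bordered_change_right[of k "concat_seq m c b'" PB b, OF PB(1)] mult.left_commute)
    also have "sgn_int \<dots> = sgn_int (detS ?I (bordered a b t C))"
      using PA(2) PB(2) by (simp add: sgn_int_mult)
    finally show ?thesis .
  qed
qed

section \<open>Diagonalization of symmetric forms\<close>

text \<open>The orthogonal complement of the kernel inside \<open>S\<close> is mapped injectively
  onto the whole image.\<close>

lemma dim_image_plus_kernel:
  fixes f :: "'a::euclidean_space \<Rightarrow> 'b::euclidean_space"
  assumes f: "linear f" and S: "subspace S"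
  shows "dim (f ` S) + dim {x \<in> S. f x = 0} = dim S"
proof -
  let ?K = "{x \<in> S. f x = 0}"
  let ?C = "{y \<in> S. \<forall>x\<in>?K. orthogonal x y}"
  have K: "subspace ?K"
    using S f by (auto simp: subspace_def linear_add linear_cmul linear_0)
  have C: "subspace ?C"
    using S by (auto simp: subspace_def orthogonal_def inner_add_right)
  have "f ` S \<subseteq> f ` ?C"
  proof
    fix v assume "v \<in> f ` S"
    then obtain x where x: "x \<in> S" "v = f x" by auto
    obtain y z where yz: "x = y + z" "y \<in> span ?K" "\<And>w. w \<in> span ?K \<Longrightarrow> orthogonal z w"
      by (rule orthogonal_subspace_decomp_exists[of ?K x]) blast
    have y: "y \<in> ?K" using yz(2) K by (metis span_eq_iff)
    have "z = x - y" using yz(1) by simp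
    then have "z \<in> S" using x(1) y S subspace_diff by blast
    moreover have "orthogonal w z" if "w \<in> ?K" for w
      using yz(3)[OF span_base[OF that]] by (simp add: orthogonal_commute)
    moreover have "v = f z" using x(2) yz(1) y f by (simp add: linear_add)
    ultimately show "v \<in> f ` ?C" by blast
  qed
  moreover have "f ` ?C \<subseteq> f ` S" by (rule image_mono) simp
  ultimately have im: "f ` S = f ` ?C" by (rule subset_antisym)
  have "span ?C = ?C" using C by (simp only: span_eq_iff)
  moreover have "inj_on f ?C"
  proof (rule inj_onI)
    fix x y assume xy: "x \<in> ?C" "y \<in> ?C" "f x = f y"
    then have "x - y \<in> ?C" using C subspace_diff by blast
    moreover have "f (x - y) = 0" using xy f by (simp add: linear_diff)
    ultimately have "orthogonal (x - y) (x - y)" by simp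
    then show "x = y" by (simp add: orthogonal_self)
  qed
  ultimately have "inj_on f (span ?C)" by (simp only:)
  then have "dim (f ` ?C) = dim ?C" by (rule dim_image_eq[OF f])
  moreover have "dim ?C + dim ?K = dim S"
    by (rule dim_subspace_orthogonal_to_vectors) (use K S in auto)
  ultimately show ?thesis using im by simp
qed

lemma span_basis_subset:
  fixes y :: "nat \<Rightarrow> 'a::euclidean_space"
  assumes y: "is_basis_of U n y" and I: "I \<subseteq> {..<n}"
  shows "dim (span (y ` I)) = card I"
    and "x \<in> span (y ` I) \<Longrightarrow> \<exists>p. x = (\<Sum>i\<in>I. p i *\<^sub>R y i)"
proof -
  have inj: "inj_on y I"
    using y I inj_on_subset unfolding is_basis_of_def by blast
  have ind: "independent (y ` I)"
    by (rule independent_mono[OF _ image_mono[OF I]]) (use y in \<open>simp add: is_basis_of_def\<close>)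
  show "dim (span (y ` I)) = card I"
    using ind inj by (simp add: dim_eq_card_independent card_image)
  have "finite I" using I finite_subset by blast
  then show "\<exists>p. x = (\<Sum>i\<in>I. p i *\<^sub>R y i)" if "x \<in> span (y ` I)"
    using that inj by (auto simp: span_finite sum.reindex)
qed

lemma orthogonal_form_expand:
  assumes B: "bounded_bilinear B" and "finite I"
    and orth: "\<And>i j. i \<in> I \<Longrightarrow> j \<in> I \<Longrightarrow> i \<noteq> j \<Longrightarrow> B (y i) (y j) = (0::real)"
  shows "B (\<Sum>i\<in>I. p i *\<^sub>R y i) (\<Sum>i\<in>I. p i *\<^sub>R y i) = (\<Sum>i\<in>I. (p i)\<^sup>2 * B (y i) (y i))"
proof -
  interpret B: bounded_bilinear B by fact
  have "B (\<Sum>i\<in>I. p i *\<^sub>R y i) (\<Sum>j\<in>I. p j *\<^sub>R y j) = (\<Sum>i\<in>I. \<Sum>j\<in>I. p i * (p j * B (y i) (y j)))"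
    by (simp only: B.sum_left) (simp add: B.sum_right B.scaleR_left B.scaleR_right sum_distrib_left mult.left_commute)
  also have "\<dots> = (\<Sum>i\<in>I. \<Sum>j\<in>I. if i = j then (p i)\<^sup>2 * B (y i) (y i) else 0)"
    by (intro sum.cong refl) (auto simp: orth power2_eq_square)
  finally show ?thesis using assms(2) by simp
qed

text \<open>The form may be indefinite and degenerate. A vector with \<open>B v v\<close> nonzero is
  split off and its orthogonal hyperplane treated by induction; if there is none, polarization makes
  the form vanish on \<open>U\<close> and any basis serves. Symmetry is asked on \<open>U\<close>
  alone because \<open>form\<close> is to be used there.\<close>

lemma orthogonal_basis_exists:
  fixes U :: "'a::euclidean_space set"
  assumes "bounded_bilinear B" "subspace U"
    and "\<And>x y. x \<in> U \<Longrightarrow> y \<in> U \<Longrightarrow> B x y = (B y x :: real)"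
  shows "\<exists>y. is_basis_of U (dim U) y \<and> (\<forall>i<dim U. \<forall>j<dim U. i \<noteq> j \<longrightarrow> B (y i) (y j) = 0)"
  using assms(2,3)
proof (induction "dim U" arbitrary: U)
  case 0
  then show ?case using is_basis_of_exists[OF 0(2)] by (metis not_less0)
next
  case (Suc n U)
  interpret B: bounded_bilinear B by fact
  show ?case
  proof (cases "\<forall>x\<in>U. B x x = 0")
    case True
    have "B x y = 0" if xy: "x \<in> U" "y \<in> U" for x y
    proof -
      have "B (x + y) (x + y) = 0" using True xy Suc.prems(1) subspace_add by blast
      then show ?thesis
        using True xy Suc.prems(2)[OF xy] by (simp add: B.add_left B.add_right)
    qed
    moreover obtain y where "is_basis_of U (dim U) y" using is_basis_of_exists[OF Suc.prems(1)] .
    ultimately show ?thesis using is_basis_of_mem by blast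
  next
    case False
    then obtain v where v: "v \<in> U" "B v v \<noteq> 0" by blast
    let ?U = "{x \<in> U. B v x = 0}"
    have lin: "linear (B v)" using B.bounded_linear_right bounded_linear.linear by blast
    have "B v ` U = UNIV"
    proof (intro equalityI subsetI)
      fix r :: real
      show "r \<in> B v ` U"
        using v Suc.prems(1)
        by (intro image_eqI[of _ _ "(r / B v v) *\<^sub>R v"]) (auto simp: B.scaleR_right subspace_mul)
    qed simp
    then have "dim ?U = n"
      using dim_image_plus_kernel[OF lin Suc.prems(1)] Suc.hyps(2) by simp
    moreover have sub: "subspace ?U"
      using Suc.prems(1) by (auto simp: subspace_def B.add_right B.scaleR_right B.zero_right)
    ultimately obtain y where y: "is_basis_of ?U n y" "\<forall>i<n. \<forall>j<n. i \<noteq> j \<longrightarrow> B (y i) (y j) = 0"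
      using Suc.hyps(1)[of ?U] Suc.prems(2) by auto
    have yU: "y i \<in> U" "B v (y i) = 0" if "i < n" for i using is_basis_of_mem[OF y(1) that] by auto
    then have yv: "B (y i) v = 0" if "i < n" for i
      using Suc.prems(2)[OF v(1), of "y i"] that by simp
    let ?y = "case_nat v y"
    have "is_basis_of U (Suc n) ?y"
    proof (rule is_basis_ofI[OF Suc.prems(1)])
      show "?y i \<in> U" if "i < Suc n" for i using that v yU by (cases i) auto
      show "dim U \<le> Suc n" using Suc.hyps by simp
      fix p assume "(\<Sum>i<Suc n. p i *\<^sub>R ?y i) = 0"
      then have s: "p 0 *\<^sub>R v + (\<Sum>i<n. p (Suc i) *\<^sub>R y i) = 0"
        by (simp add: sum.lessThan_Suc_shift del: sum.lessThan_Suc)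
      then have "B v (p 0 *\<^sub>R v + (\<Sum>i<n. p (Suc i) *\<^sub>R y i)) = 0" by (simp add: B.zero_right)
      then have "p 0 * B v v = 0"
        using yU by (simp add: B.add_right B.sum_right B.scaleR_right)
      then have p0: "p 0 = 0" using v by simp
      then have "p (Suc i) = 0" if "i < n" for i
        using is_basis_of_coeff_zero[OF y(1), of "\<lambda>i. p (Suc i)"] s that by simp
      then show "\<forall>i<Suc n. p i = 0" using p0 by (metis less_Suc_eq_0_disj)
    qed
    moreover have "B (?y i) (?y j) = 0" if "i < Suc n" "j < Suc n" "i \<noteq> j" for i j
      using that y(2) yU yv by (cases i; cases j) auto
    ultimately show ?thesis using Suc.hyps(2) by (intro exI[of _ ?y]) auto
  qed
qed

text \<open>Sylvester's law of inertia. A positive subspace meets the span of the \<open>y i\<close>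
  with \<open>B (y i) (y i) \<le> 0\<close> only in 0, which bounds its dimension; the span of the
  positive \<open>y i\<close> attains the bound.\<close>

lemma pos_index_orthogonal_basis:
  fixes U :: "'a::euclidean_space set"
  assumes B: "bounded_bilinear (B :: 'a \<Rightarrow> 'a \<Rightarrow> real)" and y: "is_basis_of U n y"
    and orth: "\<And>i j. i < n \<Longrightarrow> j < n \<Longrightarrow> i \<noteq> j \<Longrightarrow> B (y i) (y j) = 0"
  shows "pos_index B U = card {i. i < n \<and> B (y i) (y i) > 0}"
  unfolding pos_index_def
proof (rule Max_eqI)
  interpret B: bounded_bilinear B by fact
  let ?D = "{dim S | S. subspace S \<and> S \<subseteq> U \<and> (\<forall>x\<in>S. x \<noteq> 0 \<longrightarrow> B x x > 0)}"
  let ?I = "{i. i < n \<and> B (y i) (y i) > 0}" and ?J = "{i. i < n \<and> B (y i) (y i) \<le> 0}"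
  have U: "subspace U" "dim U = n" using y is_basis_of_subspace is_basis_of_dim by auto
  have sub: "span (y ` I) \<subseteq> U" if "I \<subseteq> {..<n}" for I
    by (rule span_minimal) (use that is_basis_of_mem[OF y] U in auto)
  have card: "card ?I + card ?J = n"
  proof -
    have "card (?I \<union> ?J) = card ?I + card ?J" by (rule card_Un_disjoint) auto
    moreover have "?I \<union> ?J = {..<n}" by auto
    ultimately show ?thesis by simp
  qed
  have ex: "B (\<Sum>i\<in>I. p i *\<^sub>R y i) (\<Sum>i\<in>I. p i *\<^sub>R y i) = (\<Sum>i\<in>I. (p i)\<^sup>2 * B (y i) (y i))"
    if "I \<subseteq> {..<n}" for I p
    by (rule orthogonal_form_expand[OF B])
      (use that orth in \<open>auto intro: finite_subset[OF that]\<close>)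
  show "finite ?D"
    by (rule finite_subset[of _ "{..DIM('a)}"]) (auto simp: dim_subset_UNIV)
  show "d \<le> card ?I" if d: "d \<in> ?D" for d
  proof -
    obtain S where S: "d = dim S" "subspace S" "S \<subseteq> U" "\<And>x. x \<in> S \<Longrightarrow> x \<noteq> 0 \<Longrightarrow> B x x > 0"
      using d by auto
    let ?T = "span (y ` ?J)"
    have "S \<inter> ?T \<subseteq> {0}"
    proof
      fix x assume x: "x \<in> S \<inter> ?T"
      then obtain p where p: "x = (\<Sum>i\<in>?J. p i *\<^sub>R y i)"
        using span_basis_subset(2)[OF y, of ?J x] by auto
      have "B x x \<le> 0" unfolding p
        by (subst ex) (auto intro!: sum_nonpos simp: mult_nonneg_nonpos)
      then show "x \<in> {0}" using S(4)[of x] x by auto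
    qed
    then have "dim (S \<inter> ?T) = 0" using dim_eq_0 by blast
    moreover have "{x + y |x y. x \<in> S \<and> y \<in> ?T} \<subseteq> U"
      using S(3) sub[of ?J] U(1) by (auto intro!: subspace_add)
    then have "dim {x + y |x y. x \<in> S \<and> y \<in> ?T} \<le> n" using dim_subset[of _ U] U(2) by simp
    moreover have "dim {x + y |x y. x \<in> S \<and> y \<in> ?T} + dim (S \<inter> ?T) = dim S + dim ?T"
      by (rule dim_sums_Int) (use S in auto)
    moreover have "dim ?T = card ?J" by (rule span_basis_subset(1)[OF y]) auto
    ultimately show ?thesis using card S(1) by linarith
  qed
  let ?S = "span (y ` ?I)"
  have dimS: "card ?I = dim ?S" by (rule span_basis_subset(1)[OF y, symmetric]) auto
  have pos: "B x x > 0" if x: "x \<in> ?S" "x \<noteq> 0" for x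
  proof -
    obtain p where p: "x = (\<Sum>i\<in>?I. p i *\<^sub>R y i)"
      using span_basis_subset(2)[OF y _ x(1)] by auto
    have "\<exists>i\<in>?I. p i \<noteq> 0"
    proof (rule ccontr)
      assume "\<not> (\<exists>i\<in>?I. p i \<noteq> 0)"
      then have "x = 0" unfolding p by (intro sum.neutral) auto
      then show False using x by simp
    qed
    then obtain i where i: "i \<in> ?I" "p i \<noteq> 0" by blast
    have "0 < (\<Sum>i\<in>?I. (p i)\<^sup>2 * B (y i) (y i))"
      by (rule sum_pos2[OF _ i(1)]) (use i in auto)
    also have "\<dots> = B x x" unfolding p by (rule ex[symmetric]) auto
    finally show ?thesis .
  qed
  have "?S \<subseteq> U" by (rule sub) auto
  then have "card ?I = dim ?S \<and> subspace ?S \<and> ?S \<subseteq> U \<and> (\<forall>x\<in>?S. x \<noteq> 0 \<longrightarrow> B x x > 0)"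
    by (intro conjI ballI impI) (rule dimS subspace_span pos | assumption)+
  then show "card ?I \<in> ?D" by (intro CollectI exI[of _ ?S])
qed

lemma neg_index_eq_pos_index: "neg_index B U = pos_index (\<lambda>x y. - B x y) U"
  by (simp add: neg_index_def pos_index_def)

lemma neg_index_orthogonal_basis:
  fixes U :: "'a::euclidean_space set"
  assumes B: "bounded_bilinear (B :: 'a \<Rightarrow> 'a \<Rightarrow> real)" and y: "is_basis_of U n y"
    and orth: "\<And>i j. i < n \<Longrightarrow> j < n \<Longrightarrow> i \<noteq> j \<Longrightarrow> B (y i) (y j) = 0"
  shows "neg_index B U = card {i. i < n \<and> B (y i) (y i) < 0}"
proof -
  interpret B: bounded_bilinear B by fact
  have "(\<lambda>x y. - B x y) = (\<lambda>x. B (- x))" by (simp add: fun_eq_iff B.minus_left)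
  then have "bounded_bilinear (\<lambda>x y. - B x y)"
    using B.comp1[OF bounded_linear_minus[OF bounded_linear_ident]] by simp
  from pos_index_orthogonal_basis[OF this y] orth show ?thesis
    by (simp add: neg_index_eq_pos_index)
qed

text \<open>Pairing with \<open>y i\<close> isolates the coefficient of \<open>y i\<close> times
  \<open>B (y i) (y i)\<close>, so a radical vector involves isotropic basis vectors only.\<close>

lemma dim_radical_orthogonal_basis:
  fixes U :: "'a::euclidean_space set"
  assumes B: "bounded_bilinear (B :: 'a \<Rightarrow> 'a \<Rightarrow> real)" and y: "is_basis_of U n y"
    and orth: "\<And>i j. i < n \<Longrightarrow> j < n \<Longrightarrow> i \<noteq> j \<Longrightarrow> B (y i) (y j) = 0"
  shows "dim {x \<in> U. \<forall>z\<in>U. B x z = 0} = card {i. i < n \<and> B (y i) (y i) = 0}"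
proof -
  interpret B: bounded_bilinear B by fact
  let ?Z = "{i. i < n \<and> B (y i) (y i) = 0}"
  have U: "subspace U" using y is_basis_of_subspace by auto
  have "{x \<in> U. \<forall>z\<in>U. B x z = 0} = span (y ` ?Z)"
  proof (intro equalityI subsetI)
    fix x assume x: "x \<in> {x \<in> U. \<forall>z\<in>U. B x z = 0}"
    then obtain p where p: "x = (\<Sum>i<n. p i *\<^sub>R y i)" using is_basis_of_coords[OF y, of x] by auto
    have z: "p i = 0 \<or> i \<in> ?Z" if i: "i < n" for i
    proof -
      have "0 = B x (y i)" using x is_basis_of_mem[OF y i] by simp
      also have "\<dots> = (\<Sum>j<n. p j * B (y j) (y i))" unfolding p by (simp add: B.sum_left B.scaleR_left)
      also have "\<dots> = (\<Sum>j<n. if j = i then p i * B (y i) (y i) else 0)"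
        using orth i by (intro sum.cong) auto
      finally show ?thesis using i by simp
    qed
    show "x \<in> span (y ` ?Z)" unfolding p
    proof (rule span_sum)
      fix i assume "i \<in> {..<n}"
      then show "p i *\<^sub>R y i \<in> span (y ` ?Z)"
        using z[of i] by (auto intro: span_mul span_base span_zero)
    qed
  next
    fix x assume x: "x \<in> span (y ` ?Z)"
    have "subspace {x \<in> U. \<forall>z\<in>U. B x z = 0}"
      using U by (auto simp: subspace_def B.add_left B.scaleR_left B.zero_left)
    moreover have "y ` ?Z \<subseteq> {x \<in> U. \<forall>z\<in>U. B x z = 0}"
    proof clarify
      fix i assume i: "i < n" "B (y i) (y i) = 0"
      have "B (y i) z = 0" if zU: "z \<in> U" for z
      proof -
        obtain p where p: "z = (\<Sum>j<n. p j *\<^sub>R y j)" 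
          by (rule is_basis_of_coords[OF y zU])
        have "B (y i) z = (\<Sum>j<n. p j * B (y i) (y j))" unfolding p by (simp add: B.sum_right B.scaleR_right)
        also have "\<dots> = 0"
        proof (rule sum.neutral, rule ballI)
          fix j assume "j \<in> {..<n}"
          then show "p j * B (y i) (y j) = 0" using i orth[of i j] by (cases "i = j") auto
        qed
        finally show ?thesis .
      qed
      then show "y i \<in> U \<and> (\<forall>z\<in>U. B (y i) z = 0)" using is_basis_of_mem[OF y i(1)] by simp
    qed
    ultimately show "x \<in> {x \<in> U. \<forall>z\<in>U. B x z = 0}" using x span_minimal by blast
  qed
  then show ?thesis using span_basis_subset(1)[OF y, of ?Z] by auto
qed

section \<open>Symplectic complements\<close>

definition omega_perp :: "'g::finite symvec set \<Rightarrow> 'g symvec set" where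
  "omega_perp S = {y. \<forall>x\<in>S. omega x y = 0}"

text \<open>The standard complex structure; it converts \<omega> into the Euclidean inner product,
  so that dimension formulas for orthogonal complements carry over.\<close>

definition Jmap :: "'g::finite symvec \<Rightarrow> 'g symvec" where
  "Jmap x = (\<chi> k. case k of Inl i \<Rightarrow> - x $ Inr i | Inr i \<Rightarrow> x $ Inl i)"

lemma sum_UNIV_Plus:
  "(\<Sum>k\<in>(UNIV :: ('a::finite + 'b::finite) set). h k) = (\<Sum>i\<in>UNIV. h (Inl i)) + (\<Sum>i\<in>UNIV. h (Inr i))"
  unfolding UNIV_Plus_UNIV[symmetric] by (simp add: sum.Plus del: UNIV_Plus_UNIV)

lemma omega_eq_inner: "omega x y = Jmap x \<bullet> y"
  by (simp add: omega_def Jmap_def inner_vec_def sum_UNIV_Plus sum_subtractf sum_negf)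

lemma linear_Jmap: "linear Jmap"
  by (rule linearI) (simp_all add: Jmap_def vec_eq_iff split: sum.split)

lemma inj_Jmap: "inj (Jmap :: 'g::finite symvec \<Rightarrow> _)"
proof (rule injI)
  fix x y :: "'g symvec" assume eq: "Jmap x = Jmap y"
  have "x $ k = y $ k" for k
  proof (cases k)
    case (Inl i)
    then show ?thesis using arg_cong[OF eq, of "\<lambda>v. v $ Inr i"] by (simp add: Jmap_def)
  next
    case (Inr i)
    then show ?thesis using arg_cong[OF eq, of "\<lambda>v. v $ Inl i"] by (simp add: Jmap_def)
  qed
  then show "x = y" by (simp add: vec_eq_iff)
qed

lemma omega_nondegenerate: "(\<And>y. omega x y = 0) \<Longrightarrow> x = 0"
  using omega_eq_inner[of x "Jmap x"] inj_Jmap linear_0[OF linear_Jmap]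
  by (metis injD inner_eq_zero_iff)

lemma subspace_omega_perp: "subspace (omega_perp S)"
  by (auto simp: subspace_def omega_perp_def omega.add_right omega.scaleR_right omega.zero_right)

lemma dim_omega_perp:
  fixes S :: "'g::finite symvec set"
  assumes "subspace S"
  shows "dim (omega_perp S) + dim S = 2 * CARD('g)"
proof -
  have "omega_perp S = {y \<in> UNIV. \<forall>x\<in>Jmap ` S. orthogonal x y}"
    by (auto simp: omega_perp_def omega_eq_inner orthogonal_def)
  moreover have "dim {y \<in> UNIV. \<forall>x\<in>Jmap ` S. orthogonal x y} + dim (Jmap ` S) = dim (UNIV :: 'g symvec set)"
    by (rule dim_subspace_orthogonal_to_vectors)
       (use assms linear_Jmap linear_subspace_image in auto)
  moreover have "dim (Jmap ` S) = dim S"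
    by (rule dim_image_eq[OF linear_Jmap inj_on_subset[OF inj_Jmap subset_UNIV]])
  ultimately show ?thesis by simp
qed

lemma omega_perp_perp:
  assumes "subspace S"
  shows "omega_perp (omega_perp S) = S"
proof -
  have "S \<subseteq> omega_perp (omega_perp S)"
  proof
    fix x assume x: "x \<in> S"
    have "omega y x = 0" if "y \<in> omega_perp S" for y
      using that x omega_swap[of y x] by (simp add: omega_perp_def)
    then show "x \<in> omega_perp (omega_perp S)" by (simp add: omega_perp_def)
  qed
  moreover have "dim (omega_perp (omega_perp S)) = dim S"
    using dim_omega_perp[OF assms] dim_omega_perp[OF subspace_omega_perp[of S]] by linarith
  ultimately show ?thesis
    using subspace_dim_equal[OF assms subspace_omega_perp, of "omega_perp S"] by simp
qed

lemma omega_perp_sums: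
  assumes "subspace S" "subspace T"
  shows "omega_perp {x + y | x y. x \<in> S \<and> y \<in> T} = omega_perp S \<inter> omega_perp T"
proof (intro equalityI subsetI)
  fix z assume z: "z \<in> omega_perp {x + y | x y. x \<in> S \<and> y \<in> T}"
  have "omega x z = 0" if "x \<in> S" for x
  proof -
    have "x + 0 \<in> {x + y | x y. x \<in> S \<and> y \<in> T}" using that assms subspace_0 by blast
    then show ?thesis using z by (simp add: omega_perp_def)
  qed
  moreover have "omega x z = 0" if "x \<in> T" for x
  proof -
    have "0 + x \<in> {x + y | x y. x \<in> S \<and> y \<in> T}" using that assms subspace_0 by blast
    then show ?thesis using z by (simp add: omega_perp_def)
  qed
  ultimately show "z \<in> omega_perp S \<inter> omega_perp T" by (simp add: omega_perp_def)
qed (auto simp: omega_perp_def omega.add_left)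

text \<open>The hypothesis says that the functionals \<open>omega (c i)\<close> are independent on
  \<open>W\<close>; the \<open>c i\<close> may lie outside \<open>W\<close>. Euclidean projection
  represents these functionals by vectors \<open>v i\<close> of \<open>W\<close>, and a family dual
  to the \<open>v i\<close> can again be projected into \<open>W\<close>.\<close>

lemma omega_dual_family_exists:
  fixes c :: "nat \<Rightarrow> 'g::finite symvec"
  assumes W: "subspace W"
    and ind: "\<And>p. (\<And>w. w \<in> W \<Longrightarrow> omega (\<Sum>i<m. p i *\<^sub>R c i) w = 0) \<Longrightarrow> \<forall>i<m. p i = 0"
  obtains t where "\<And>j. t j \<in> W"
    and "\<And>i j. i < m \<Longrightarrow> j < m \<Longrightarrow> omega (c i) (t j) = (if i = j then 1 else 0)"
proof -
  have spW: "span W = W" using W by (simp add: span_eq_iff)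
  have proj: "\<exists>v\<in>W. \<forall>w\<in>W. x \<bullet> w = v \<bullet> w" for x :: "'g symvec"
  proof -
    obtain y z where "x = y + z" "y \<in> span W" "\<And>w. w \<in> span W \<Longrightarrow> orthogonal z w"
      by (rule orthogonal_subspace_decomp_exists[of W x]) blast
    then show ?thesis
      by (intro bexI[of _ y]) (auto simp: spW orthogonal_def inner_add_left)
  qed
  then have "\<forall>i. \<exists>v. v \<in> W \<and> (\<forall>w\<in>W. omega (c i) w = v \<bullet> w)"
    unfolding omega_eq_inner by blast
  then obtain v where v: "\<And>i. v i \<in> W" "\<And>i w. w \<in> W \<Longrightarrow> omega (c i) w = v i \<bullet> w"
    by metis
  have ind_v: "\<forall>i<m. p i = 0" if p: "(\<Sum>i<m. p i *\<^sub>R v i) = 0" for p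
  proof (rule ind)
    fix w assume w: "w \<in> W"
    have "omega (\<Sum>i<m. p i *\<^sub>R c i) w = (\<Sum>i<m. p i *\<^sub>R v i) \<bullet> w"
      by (simp add: omega.sum_left omega.scaleR_left v(2)[OF w] inner_sum_left)
    then show "omega (\<Sum>i<m. p i *\<^sub>R c i) w = 0" using p by simp
  qed
  have bv: "is_basis_of (span (v ` {..<m})) m v"
  proof (rule is_basis_ofI)
    show "dim (span (v ` {..<m})) \<le> m"
      by (metis card_image_le card_lessThan dim_le_card dim_span finite_imageI finite_lessThan le_trans span_superset)
  qed (use ind_v in \<open>auto intro: span_base\<close>)
  have "\<exists>t\<in>W. \<forall>i<m. omega (c i) t = (if i = j then 1 else 0)" if j: "j < m" for j
  proof -
    obtain h :: "'g symvec \<Rightarrow> real" where h: "linear h"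
      "\<forall>x\<in>v ` {..<m}. h x = (if x = v j then 1 else 0)"
      using linear_independent_extend[of "v ` {..<m}" "\<lambda>x. if x = v j then 1 else (0::real)"] bv
      by (auto simp: is_basis_of_def)
    have hx: "h x = x \<bullet> adjoint h 1" for x
      using adjoint_works[OF h(1), of x 1] by simp
    obtain t where t: "t \<in> W" "\<forall>w\<in>W. adjoint h 1 \<bullet> w = t \<bullet> w" using proj by blast
    have "omega (c i) t = (if i = j then 1 else 0)" if i: "i < m" for i
    proof -
      have "omega (c i) t = h (v i)"
        using v(2)[OF t(1)] t(2) v(1)[of i] hx by (simp add: inner_commute)
      moreover have "v i = v j \<longleftrightarrow> i = j"
        using bv i j by (auto simp: is_basis_of_def inj_on_def)
      ultimately show ?thesis using h(2) i by simp
    qed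
    then show ?thesis using t(1) by blast
  qed
  then have "\<forall>j. \<exists>t. t \<in> W \<and> (j < m \<longrightarrow> (\<forall>i<m. omega (c i) t = (if i = j then 1 else 0)))"
    using subspace_0[OF W] by blast
  then obtain t where "\<forall>j. t j \<in> W \<and> (j < m \<longrightarrow> (\<forall>i<m. omega (c i) (t j) = (if i = j then 1 else 0)))"
    by metis
  then show thesis by (intro that[of t]) auto
qed

section \<open>The standard lagrangian\<close>

lemma lambda0_eq: "lambda0 = {x :: 'g::finite symvec. \<forall>i. x $ Inr i = 0}"
proof (intro equalityI subsetI)
  fix x :: "'g symvec" assume "x \<in> lambda0"
  moreover have "subspace {x :: 'g symvec. \<forall>i. x $ Inr i = 0}"
    by (auto simp: subspace_def)
  moreover have "range pvec \<subseteq> {x :: 'g symvec. \<forall>i. x $ Inr i = 0}"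
    by (auto simp: pvec_def axis_def)
  ultimately show "x \<in> {x. \<forall>i. x $ Inr i = 0}"
    unfolding lambda0_def using span_minimal by blast
next
  fix x :: "'g symvec" assume x: "x \<in> {x. \<forall>i. x $ Inr i = 0}"
  have "x = (\<Sum>i\<in>UNIV. x $ Inl i *\<^sub>R pvec i)"
    unfolding vec_eq_iff
  proof
    fix k
    show "x $ k = (\<Sum>i\<in>UNIV. x $ Inl i *\<^sub>R pvec i) $ k"
      using x by (cases k) (auto simp: pvec_def axis_def if_distrib cong: if_cong)
  qed
  then show "x \<in> lambda0"
    unfolding lambda0_def by (metis (no_types, lifting) rangeI span_base span_mul span_sum)
qed

lemma subspace_lambda0: "subspace lambda0"
  by (simp add: lambda0_def)

lemma lambda0_isotropic: "x \<in> lambda0 \<Longrightarrow> y \<in> lambda0 \<Longrightarrow> omega x y = 0"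
  by (simp add: lambda0_eq omega_def)

lemma omega_perp_lambda0: "omega_perp lambda0 = (lambda0 :: 'g::finite symvec set)"
proof (intro equalityI subsetI)
  fix y :: "'g symvec" assume y: "y \<in> omega_perp lambda0"
  have "y $ Inr i = 0" for i
  proof -
    have "pvec i \<in> (lambda0 :: 'g symvec set)" by (simp add: lambda0_def span_base)
    then have "omega (pvec i) y = 0" using y by (simp add: omega_perp_def)
    moreover have "omega (pvec i) y = (\<Sum>j\<in>UNIV. if i = j then y $ Inr j else 0)"
      unfolding omega_def by (intro sum.cong) (auto simp: pvec_def axis_def)
    ultimately show ?thesis by simp
  qed
  then show "y \<in> lambda0" by (simp add: lambda0_eq)
qed (simp add: omega_perp_def lambda0_isotropic)

lemma dim_lambda0: "dim (lambda0 :: 'g::finite symvec set) = CARD('g)"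
  using dim_omega_perp[of "lambda0 :: 'g symvec set"] by (simp add: omega_perp_lambda0 subspace_lambda0)

section \<open>The form of Gilmer and Masbaum\<close>

locale symplectic_map =
  fixes f :: "'g::finite symvec \<Rightarrow> 'g symvec"
  assumes f_Sp: "f \<in> Sp_R"
begin

abbreviation d :: "'g symvec \<Rightarrow> 'g symvec" where "d x \<equiv> f x - x"

abbreviation W :: "'g symvec set" where "W \<equiv> image_fm1 f"

definition fixed :: "'g symvec set" where "fixed = {x. d x = 0}"

lemma f_linear: "linear f" and f_omega [simp]: "omega (f x) (f y) = omega x y"
  using f_Sp by (auto simp: Sp_R_def)

lemma d_linear: "linear d"
  using f_linear by (intro linear_compose_sub) (simp_all add: linear_id[unfolded id_def])

lemma inj_f: "inj f"
proof (rule linear_injective_0[OF f_linear, THEN iffD2], intro allI impI)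
  fix x assume fx: "f x = 0"
  have "omega x y = 0" for y
    using f_omega[of x y] fx by (simp add: omega.zero_left)
  then show "x = 0" by (rule omega_nondegenerate)
qed

lemma subspace_W: "subspace W"
  unfolding image_fm1_def by (rule linear_subspace_image[OF d_linear]) simp

lemma subspace_fixed: "subspace fixed"
  unfolding fixed_def by (rule linear_subspace_kernel[OF d_linear])

lemma dim_W: "dim W + dim fixed = 2 * CARD('g)"
  using dim_image_plus_kernel[OF d_linear subspace_UNIV] by (simp add: image_fm1_def fixed_def)

lemma omega_fixed_d: "n \<in> fixed \<Longrightarrow> omega n (d x) = 0"
  using f_omega[of n x] by (simp add: fixed_def omega.diff_right)

text \<open>Containment is the invariance of \<omega> under \<open>f\<close>. Equality follows by
  dimension, since rank and nullity, like a subspace and its complement, add up to 2g.\<close>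

lemma W_eq: "W = omega_perp fixed"
proof (rule subspace_dim_equal[OF subspace_W subspace_omega_perp])
  show "W \<subseteq> omega_perp fixed"
    by (auto simp: image_fm1_def omega_perp_def omega_fixed_d)
  show "dim (omega_perp fixed) \<le> dim W"
    using dim_omega_perp[OF subspace_fixed] dim_W by linarith
qed

lemma omega_fixed_W: "n \<in> fixed \<Longrightarrow> w \<in> W \<Longrightarrow> omega n w = 0"
  by (auto simp: W_eq omega_perp_def)

lemma omega_eq_if_d_eq:
  assumes "d x = d y" "w \<in> W"
  shows "omega x w = omega y w"
proof -
  have "x - y \<in> fixed" using assms(1) linear_diff[OF d_linear, of x y] by (simp add: fixed_def)
  from omega_fixed_W[OF this assms(2)] show ?thesis by (simp add: omega.diff_left)
qed

lemma star_d: "w \<in> W \<Longrightarrow> star f (d x) w = omega x w"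
  unfolding star_def by (rule omega_eq_if_d_eq) (rule someI, auto)

text \<open>A linear section of \<open>d\<close> over \<open>W\<close>, in place of the choice
  inside \<open>star\<close>, which is made vector by vector. Both give the same form on
  \<open>W\<close> because preimages differ by elements of \<open>fixed\<close>, which are
  orthogonal to \<open>W\<close>.\<close>

definition h :: "'g symvec \<Rightarrow> 'g symvec" where
  "h = (SOME h. linear h \<and> (\<forall>w\<in>W. d (h w) = w))"

lemma h_linear: "linear h" and d_h: "w \<in> W \<Longrightarrow> d (h w) = w"
proof -
  have "\<exists>h. linear h \<and> (\<forall>w\<in>W. d (h w) = w)"
    using linear_exists_right_inverse_on[OF d_linear subspace_UNIV] by (auto simp: image_fm1_def)
  then have "linear h \<and> (\<forall>w\<in>W. d (h w) = w)" unfolding h_def by (rule someI_ex)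
  then show "linear h" "w \<in> W \<Longrightarrow> d (h w) = w" by auto
qed

text \<open>A bilinear extension of \<open>star f\<close> from \<open>W\<close> to the whole space, where \<open>star f\<close> itself takes
  unspecified values.\<close>

definition form :: "'g symvec \<Rightarrow> 'g symvec \<Rightarrow> real" where
  "form a b = omega (h a) b"

lemma form_bilinear: "bounded_bilinear form"
  using omega.comp1[of h] h_linear by (simp add: form_def[abs_def] linear_conv_bounded_linear)

lemma star_eq_form: "a \<in> W \<Longrightarrow> b \<in> W \<Longrightarrow> star f a b = form a b"
  using star_d[of b "h a"] by (simp add: d_h form_def)

lemma form_d: "w \<in> W \<Longrightarrow> form (d x) w = omega x w"
  using star_d[of w x] star_eq_form[of "d x" w] by (simp add: image_fm1_def)

text \<open>For preimages \<open>x\<close> and \<open>y\<close> this is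
  \<open>omega (f x) (f y) = omega x y\<close> expanded. The failure of symmetry is thus \<omega>
  itself, which vanishes on isotropic parts of \<open>W\<close>.\<close>

lemma form_swap: "a \<in> W \<Longrightarrow> b \<in> W \<Longrightarrow> form a b = form b a - omega a b"
proof -
  assume "a \<in> W" "b \<in> W"
  then obtain x y where xy: "a = d x" "b = d y" by (auto simp: image_fm1_def)
  have "form a b = omega x (d y)" "form b a = omega y (d x)"
    using form_d \<open>a \<in> W\<close> \<open>b \<in> W\<close> xy by auto
  then show ?thesis
    using f_omega[of x y] omega_swap[of y x] omega_swap[of y "f x"]
    by (simp add: xy omega.diff_left omega.diff_right)
qed

text \<open>The preimages \<open>h (b i)\<close> are independent modulo \<open>fixed\<close>, the
  complement of \<open>W\<close>, so \<open>W\<close> contains a family dual to them. Its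
  coordinates in the basis \<open>b\<close> invert the Gram matrix.\<close>

lemma form_gram_nonzero:
  assumes b: "is_basis_of W n b"
  shows "detS {..<n} (\<lambda>i j. form (b i) (b j)) \<noteq> 0"
proof -
  obtain t where t: "\<And>j. t j \<in> W"
    "\<And>i j. i < n \<Longrightarrow> j < n \<Longrightarrow> omega (h (b i)) (t j) = (if i = j then 1 else 0)"
  proof (rule omega_dual_family_exists[OF subspace_W, where m = n and c = "\<lambda>i. h (b i)"])
    fix p assume p: "\<And>w. w \<in> W \<Longrightarrow> omega (\<Sum>i<n. p i *\<^sub>R h (b i)) w = 0"
    let ?v = "\<Sum>i<n. p i *\<^sub>R h (b i)"
    have "omega w ?v = 0" if "w \<in> W" for w
      using p[OF that] omega_swap[of w ?v] by simp
    then have "?v \<in> omega_perp W" by (simp add: omega_perp_def)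
    then have "?v \<in> fixed" unfolding W_eq omega_perp_perp[OF subspace_fixed] .
    then have "d ?v = 0" by (simp add: fixed_def)
    moreover have "d ?v = (\<Sum>i<n. p i *\<^sub>R d (h (b i)))"
      by (subst linear_sum[OF d_linear]) (simp add: linear_cmul[OF d_linear])
    ultimately have "(\<Sum>i<n. p i *\<^sub>R b i) = 0"
      using is_basis_of_mem[OF b] by (simp add: d_h)
    then show "\<forall>i<n. p i = 0" using is_basis_of_coeff_zero[OF b] by blast
  qed blast
  have "\<forall>j. \<exists>q. t j = (\<Sum>l<n. q l *\<^sub>R b l)"
    using is_basis_of_coords[OF b t(1)] by metis
  then obtain Q where Q: "\<And>j. t j = (\<Sum>l<n. Q j l *\<^sub>R b l)" by metis
  have "detS {..<n} (\<lambda>i j. \<Sum>l<n. form (b i) (b l) * Q j l) =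
      detS {..<n} (\<lambda>i j. form (b i) (b j)) * detS {..<n} (\<lambda>i j. Q j i)"
    by (rule detS_mult) simp
  moreover have "(\<Sum>l<n. form (b i) (b l) * Q j l) = (if i = j then 1 else 0)"
    if "i < n" "j < n" for i j
    using t(2)[OF that] unfolding form_def Q
    by (simp add: omega.sum_right omega.scaleR_right mult.commute)
  then have "detS {..<n} (\<lambda>i j. \<Sum>l<n. form (b i) (b l) * Q j l) = 1"
    by (subst detS_diagonal) simp_all
  ultimately show ?thesis by auto
qed

lemma sgn_gram_basis_independent:
  assumes a: "is_basis_of W n a" and b: "is_basis_of W n b"
  shows "sgn_int (detS {..<n} (\<lambda>i j. form (b i) (b j))) = sgn_int (detS {..<n} (\<lambda>i j. form (a i) (a j)))"
proof -
  interpret B: bounded_bilinear form by (rule form_bilinear)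
  obtain P Q where P: "\<And>j. j < n \<Longrightarrow> b j = (\<Sum>i<n. P i j *\<^sub>R a i)"
    and PQ: "detS {..<n} Q * detS {..<n} P = 1"
    by (rule is_basis_of_transition[OF a b]) blast
  have "detS {..<n} (\<lambda>i j. form (b i) (b j)) = detS {..<n} (\<lambda>i j. P j i) * detS {..<n} (\<lambda>i j. form (a i) (b j))"
    by (rule detS_change_rows) (auto simp: P B.sum_left B.scaleR_left)
  moreover have "detS {..<n} (\<lambda>i j. form (a i) (b j)) = detS {..<n} P * detS {..<n} (\<lambda>i j. form (a i) (a j))"
    by (rule detS_change_cols) (auto simp: P B.sum_right B.scaleR_right)
  moreover have "detS {..<n} (\<lambda>i j. P j i) = detS {..<n} P" by (rule detS_transpose) simp
  moreover have "sgn_int (detS {..<n} P) * sgn_int (detS {..<n} P) = 1"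
    using PQ by (auto simp: sgn_int_def)
  ultimately show ?thesis by (simp add: sgn_int_mult mult.assoc[symmetric])
qed

text \<open>Frees the sign from the chosen basis. For \<open>W = {0}\<close> the empty determinant
  reproduces the convention for the identity.\<close>

lemma sgn_det_star_eq:
  assumes b: "is_basis_of W n b"
  shows "sgn_det_star f = sgn_int (detS {..<n} (\<lambda>i j. form (b i) (b j)))"
proof -
  have n: "dim W = n" by (rule is_basis_of_dim[OF b])
  show ?thesis
  proof (cases "W = {0}")
    case True
    then have "n = 0" using n by simp
    then show ?thesis using True by (simp add: sgn_det_star_def)
  next
    case False
    define a where "a = (SOME b. is_basis_of W n b)"
    have a: "is_basis_of W n a" unfolding a_def by (rule someI[of _ b]) (rule b)
    have "sgn_det_star f = sgn_int (detS {..<n} (\<lambda>i j. star f (a i) (a j)))"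
      using False by (simp add: sgn_det_star_def Let_def n a_def det_n_eq_detS)
    also have "detS {..<n} (\<lambda>i j. star f (a i) (a j)) = detS {..<n} (\<lambda>i j. form (a i) (a j))"
      by (rule detS_cong) (use is_basis_of_mem[OF a] star_eq_form in auto)
    finally show ?thesis using sgn_gram_basis_independent[OF a b] by simp
  qed
qed

section \<open>The form restricted to the lagrangian and its radical\<close>

abbreviation U :: "'g symvec set" where "U \<equiv> lambda0 \<inter> W"

lemma subspace_U: "subspace U"
  by (rule subspace_inter[OF subspace_lambda0 subspace_W])

lemma form_symmetric: "a \<in> U \<Longrightarrow> b \<in> U \<Longrightarrow> form a b = form b a"
  using form_swap[of a b] lambda0_isotropic[of a b] by simp

lemma subspace_lambda0_plus_fixed: "subspace {x + y | x y. x \<in> lambda0 \<and> y \<in> fixed}"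
  by (rule subspace_sums[OF subspace_lambda0 subspace_fixed])

text \<open>Both factors are complements, \<open>lambda0\<close> of itself and \<open>W\<close> of
  \<open>fixed\<close>, so their intersection is the complement of the sum.\<close>

lemma U_eq: "U = omega_perp {x + y | x y. x \<in> lambda0 \<and> y \<in> fixed}"
  by (simp only: omega_perp_sums[OF subspace_lambda0 subspace_fixed] omega_perp_lambda0 W_eq)

lemma dim_U: "dim U + CARD('g) = dim W + dim (lambda0 \<inter> fixed)"
  using dim_omega_perp[OF subspace_lambda0_plus_fixed] dim_sums_Int[OF subspace_lambda0 subspace_fixed]
    dim_W dim_lambda0[where 'g = 'g]
  by (simp only: U_eq[symmetric])

text \<open>A preimage of a radical vector is orthogonal to \<open>U\<close>, hence lies in the sum
  of \<open>lambda0\<close> and \<open>fixed\<close>. Its part in \<open>fixed\<close> dies under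
  \<open>d\<close>, so the preimage may be taken in \<open>lambda0\<close>.\<close>

lemma radical_eq: "{x \<in> U. \<forall>z\<in>U. form x z = 0} = d ` {l \<in> lambda0. f l \<in> lambda0}"
proof (intro equalityI subsetI)
  fix x assume "x \<in> {x \<in> U. \<forall>z\<in>U. form x z = 0}"
  then have x: "x \<in> lambda0" "x \<in> W" "\<And>z. z \<in> U \<Longrightarrow> omega (h x) z = 0"
    by (auto simp: form_def)
  have "omega z (h x) = 0" if "z \<in> U" for z
    using x(3)[OF that] omega_swap[of z "h x"] by simp
  then have "h x \<in> omega_perp U" by (simp add: omega_perp_def)
  then have "h x \<in> {x + y | x y. x \<in> lambda0 \<and> y \<in> fixed}"
    unfolding U_eq omega_perp_perp[OF subspace_lambda0_plus_fixed] .
  then obtain l n where ln: "h x = l + n" "l \<in> lambda0" "n \<in> fixed" by blast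
  have "x = d l + d n" using d_h[OF x(2)] ln(1) linear_add[OF d_linear, of l n] by simp
  then have xl: "x = d l" using ln(3) by (simp add: fixed_def)
  then have "f l = x + l" by simp
  then have "f l \<in> lambda0" using x(1) ln(2) subspace_add[OF subspace_lambda0] by metis
  then show "x \<in> d ` {l \<in> lambda0. f l \<in> lambda0}" using xl ln(2) by blast
next
  fix x assume "x \<in> d ` {l \<in> lambda0. f l \<in> lambda0}"
  then obtain l where l: "l \<in> lambda0" "f l \<in> lambda0" "x = d l" by blast
  then have "x \<in> U" using subspace_diff[OF subspace_lambda0] by (simp add: image_fm1_def)
  moreover have "form x z = 0" if "z \<in> U" for z
    using that form_d[of z l] l lambda0_isotropic[of l z] by simp
  ultimately show "x \<in> {x \<in> U. \<forall>z\<in>U. form x z = 0}" by simp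
qed

text \<open>Rank and nullity of \<open>d\<close> on the space \<open>?K\<close> of
  \<open>radical_eq\<close>: the kernel is \<open>lambda0 \<inter> fixed\<close>, and
  \<open>f\<close> maps \<open>?K\<close> isomorphically onto the intersection of
  \<open>lambda0\<close> with its image.\<close>

lemma dim_radical:
  "dim {x \<in> U. \<forall>z\<in>U. form x z = 0} + dim (lambda0 \<inter> fixed) = dim (lambda0 \<inter> f ` lambda0)"
proof -
  let ?K = "{l \<in> lambda0. f l \<in> lambda0}"
  have sub: "subspace ?K"
    using subspace_lambda0 f_linear
    by (auto simp: subspace_def linear_add linear_cmul linear_0)
  have "dim (d ` ?K) + dim {x \<in> ?K. d x = 0} = dim ?K"
    by (rule dim_image_plus_kernel[OF d_linear sub])
  moreover have "{x \<in> ?K. d x = 0} = lambda0 \<inter> fixed" by (auto simp: fixed_def)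
  moreover have "dim (f ` ?K) = dim ?K"
    by (rule dim_image_eq[OF f_linear inj_on_subset[OF inj_f subset_UNIV]])
  moreover have "f ` ?K = lambda0 \<inter> f ` lambda0" by auto
  ultimately show ?thesis unfolding radical_eq by simp
qed

end

lemma pos_index_cong: "(\<And>x. x \<in> U \<Longrightarrow> B x x = B' x x) \<Longrightarrow> pos_index B U = pos_index B' U"
  unfolding pos_index_def by (metis (no_types, lifting) subsetD)

lemma sgn_int_prod: "finite Z \<Longrightarrow> sgn_int (\<Prod>i\<in>Z. x i) = (\<Prod>i\<in>Z. sgn_int (x i))"
  by (induction Z rule: finite_induct) (simp_all add: sgn_int_mult)

lemma prod_sgn_int_nonzero:
  assumes "finite Z" "\<And>i. i \<in> Z \<Longrightarrow> x i \<noteq> 0"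
  shows "(\<Prod>i\<in>Z. sgn_int (x i)) = (-1) ^ card {i \<in> Z. x i < 0}"
proof -
  have "(\<Prod>i\<in>Z. sgn_int (x i)) = (\<Prod>i\<in>Z. if x i < 0 then -1 else 1)"
    by (intro prod.cong refl) (use assms(2) in \<open>auto simp: sgn_int_def linorder_neq_iff\<close>)
  also have "\<dots> = (\<Prod>i\<in>{i \<in> Z. x i < 0}. -1)"
    by (rule prod.inter_filter[symmetric, OF assms(1)])
  finally show ?thesis by simp
qed

lemma sum_lessThan_add:
  fixes h :: "nat \<Rightarrow> 'a::comm_monoid_add"
  shows "(\<Sum>i<m + n. h i) = (\<Sum>i<m. h i) + (\<Sum>i<n. h (m + i))"
  by (induction n) (simp_all add: add.assoc)

section \<open>Families adapted to the lagrangian, its image and the fixed space\<close>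

context symplectic_map
begin

text \<open>The source of the factor \<open>(-1) ^ r\<close>: a border row
  \<open>omega (d x) (f y)\<close> is the negative of a row of the pulled back form.\<close>

lemma omega_d_f: "omega (d x) (f y) = - omega x (d y)"
  by (simp add: omega.diff_left omega.diff_right)

text \<open>Pairing with \<open>c i\<close> sees only the \<open>q\<close> terms, then
  \<open>form\<close> against \<open>y l\<close> sees only the \<open>r\<close> terms. What is left
  is a combination of the \<open>al i\<close> with \<open>i \<ge> e\<close> that lies in
  \<open>lambda0 \<inter> fixed\<close>, which the first \<open>e\<close> vectors already
  span.\<close>

lemma independent_d_family:
  fixes al :: "nat \<Rightarrow> 'g symvec" and T y c :: "nat \<Rightarrow> 'g symvec"
  assumes e: "e \<le> g" "e \<le> k"
    and al: "is_basis_of lambda0 g al" and eb: "is_basis_of (lambda0 \<inter> fixed) e al"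
    and cK: "\<And>i. i < k \<Longrightarrow> c i \<in> lambda0 \<inter> f ` lambda0"
    and cT: "\<And>i j. i \<in> {e..<k} \<Longrightarrow> j \<in> {e..<k} \<Longrightarrow> omega (c i) (d (T j)) = (if i = j then 1 else 0)"
    and yU: "\<And>i. i \<in> Z \<Longrightarrow> y i \<in> U" and fin: "finite Z"
    and yo: "\<And>i j. i \<in> Z \<Longrightarrow> j \<in> Z \<Longrightarrow> i \<noteq> j \<Longrightarrow> form (y i) (y j) = 0"
    and yn: "\<And>i. i \<in> Z \<Longrightarrow> form (y i) (y i) \<noteq> 0"
    and z: "(\<Sum>i\<in>{e..<g}. p i *\<^sub>R d (al i)) + (\<Sum>j\<in>{e..<k}. q j *\<^sub>R d (T j)) + (\<Sum>l\<in>Z. r l *\<^sub>R y l) = 0"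
  shows "(\<forall>i\<in>{e..<g}. p i = 0) \<and> (\<forall>j\<in>{e..<k}. q j = 0) \<and> (\<forall>l\<in>Z. r l = 0)"
proof -
  interpret B: bounded_bilinear form by (rule form_bilinear)
  let ?a = "\<Sum>i\<in>{e..<g}. p i *\<^sub>R al i"
  have da: "(\<Sum>i\<in>{e..<g}. p i *\<^sub>R d (al i)) = d ?a"
    by (subst linear_sum[OF d_linear]) (simp add: linear_cmul[OF d_linear])
  have aL: "?a \<in> lambda0"
    by (intro subspace_sum subspace_mul subspace_lambda0) (use is_basis_of_mem[OF al] in auto)
  have q0: "q i = 0" if i: "i \<in> {e..<k}" for i
  proof -
    have ci: "c i \<in> lambda0" "c i \<in> f ` lambda0" using cK[of i] i by auto
    then obtain l where l: "c i = f l" "l \<in> lambda0" by blast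
    \<comment> \<open>\<open>c i\<close> is orthogonal to \<open>?a\<close> inside the lagrangian
      and, being \<open>f l\<close>, also to \<open>f ?a\<close>.\<close>
    have "omega (c i) (d ?a) = 0"
      using lambda0_isotropic[OF ci(1) aL] lambda0_isotropic[OF l(2) aL] l(1)
      by (simp only: omega.diff_right f_omega)
    moreover have "omega (c i) (\<Sum>l\<in>Z. r l *\<^sub>R y l) = 0"
      using lambda0_isotropic[OF ci(1)] yU by (simp add: omega.sum_right omega.scaleR_right)
    moreover have "omega (c i) (\<Sum>j\<in>{e..<k}. q j *\<^sub>R d (T j)) = (\<Sum>j\<in>{e..<k}. if j = i then q i else 0)"
      unfolding omega.sum_right omega.scaleR_right by (intro sum.cong refl) (use cT i in auto)
    moreover have "omega (c i) (d ?a + (\<Sum>j\<in>{e..<k}. q j *\<^sub>R d (T j)) + (\<Sum>l\<in>Z. r l *\<^sub>R y l)) = 0"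
      using z unfolding da by (simp add: omega.zero_right)
    ultimately show ?thesis using i by (simp only: omega.add_right) simp
  qed
  then have z2: "d ?a + (\<Sum>l\<in>Z. r l *\<^sub>R y l) = 0" using z unfolding da by simp
  have r0: "r l = 0" if l: "l \<in> Z" for l
  proof -
    have "form (d ?a) (y l) = 0"
      using form_d[of "y l" ?a] yU[OF l] lambda0_isotropic[OF aL] by simp
    moreover have "form (\<Sum>l\<in>Z. r l *\<^sub>R y l) (y l) = (\<Sum>j\<in>Z. if j = l then r l * form (y l) (y l) else 0)"
      unfolding B.sum_left B.scaleR_left by (intro sum.cong refl) (use yo l in auto)
    moreover have "form (d ?a + (\<Sum>l\<in>Z. r l *\<^sub>R y l)) (y l) = 0" using z2 by (simp add: B.zero_left)
    ultimately have "r l * form (y l) (y l) = 0" using l fin by (simp only: B.add_left) simp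
    then show ?thesis using yn[OF l] by simp
  qed
  then have "d ?a = 0" using z2 by simp
  then have "?a \<in> lambda0 \<inter> fixed" using aL by (simp add: fixed_def)
  then obtain u where u: "?a = (\<Sum>i<e. u i *\<^sub>R al i)" by (rule is_basis_of_coords[OF eb])
  let ?v = "\<lambda>i. if i < e then - u i else p i"
  have "(\<Sum>i<g. ?v i *\<^sub>R al i) = (\<Sum>i<e. ?v i *\<^sub>R al i) + (\<Sum>i\<in>{e..<g}. ?v i *\<^sub>R al i)"
    using e(1) by (subst sum.union_disjoint[symmetric]) (auto simp: ivl_disj_un_one intro!: sum.cong)
  also have "\<dots> = - (\<Sum>i<e. u i *\<^sub>R al i) + ?a" by (simp add: sum_negf)
  also have "\<dots> = 0" using u by simp
  finally have "?v i = 0" if "i < g" for i using is_basis_of_coeff_zero[OF al, of ?v i] that by blast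
  then have "p i = 0" if "i \<in> {e..<g}" for i using that by (metis atLeastLessThan_iff not_less)
  then show ?thesis using q0 r0 by blast
qed

lemma orthogonal_basis_U:
  obtains n y where "is_basis_of U n y"
    and "\<And>i j. i < n \<Longrightarrow> j < n \<Longrightarrow> i \<noteq> j \<Longrightarrow> form (y i) (y j) = 0"
    and "pos_index (star f) U = card {i. i < n \<and> form (y i) (y i) > 0}"
    and "neg_index (star f) U = card {i. i < n \<and> form (y i) (y i) < 0}"
    and "card {i. i < n \<and> form (y i) (y i) = 0} + dim (lambda0 \<inter> fixed) = dim (lambda0 \<inter> f ` lambda0)"
proof -
  obtain y where y: "is_basis_of U (dim U) y"
    and o: "\<And>i j. i < dim U \<Longrightarrow> j < dim U \<Longrightarrow> i \<noteq> j \<Longrightarrow> form (y i) (y j) = 0"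
    using orthogonal_basis_exists[OF form_bilinear subspace_U form_symmetric] by blast
  have "pos_index (star f) U = pos_index form U"
    by (rule pos_index_cong) (simp add: star_eq_form)
  moreover have "neg_index (star f) U = neg_index form U"
    unfolding neg_index_eq_pos_index by (rule pos_index_cong) (simp add: star_eq_form)
  ultimately show thesis
    using that[OF y o] pos_index_orthogonal_basis[OF form_bilinear y o]
      neg_index_orthogonal_basis[OF form_bilinear y o]
      dim_radical_orthogonal_basis[OF form_bilinear y o] dim_radical by simp
qed

text \<open>\<open>al\<close> and \<open>c\<close> begin with the same basis of
  \<open>lambda0 \<inter> fixed\<close>. A dual of one of these vectors cannot lie in
  \<open>W\<close>, the complement of \<open>fixed\<close>. The later duals can, since the rest of
  \<open>c\<close> is independent modulo \<open>fixed\<close>; lying in \<open>W\<close>, they are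
  automatically orthogonal to the shared segment.\<close>

lemma adapted_bases:
  obtains al c t where
    "is_basis_of lambda0 CARD('g) al" "is_basis_of (lambda0 \<inter> fixed) (dim (lambda0 \<inter> fixed)) al"
    "is_basis_of (lambda0 \<inter> f ` lambda0) (dim (lambda0 \<inter> f ` lambda0)) c"
    "\<And>i. i < dim (lambda0 \<inter> fixed) \<Longrightarrow> c i = al i"
    "\<And>i j. i < dim (lambda0 \<inter> f ` lambda0) \<Longrightarrow> j < dim (lambda0 \<inter> f ` lambda0) \<Longrightarrow>
       omega (c i) (t j) = (if i = j then 1 else 0)"
    "\<And>j. dim (lambda0 \<inter> fixed) \<le> j \<Longrightarrow> t j \<in> W"
proof -
  let ?E = "lambda0 \<inter> fixed" and ?K = "lambda0 \<inter> f ` lambda0"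
  let ?e = "dim ?E" and ?k = "dim ?K"
  have E: "subspace ?E" by (rule subspace_inter[OF subspace_lambda0 subspace_fixed])
  have K: "subspace ?K"
    by (intro subspace_inter subspace_lambda0 linear_subspace_image f_linear)
  have EK: "?E \<subseteq> ?K"
  proof
    fix x assume x: "x \<in> ?E"
    then have "f x = x" by (simp add: fixed_def)
    then have "x \<in> f ` lambda0" using x by (metis IntD1 imageI)
    then show "x \<in> ?K" using x by simp
  qed
  obtain eb where eb: "is_basis_of ?E ?e eb" using is_basis_of_exists[OF E] .
  obtain a' where a': "is_basis_of lambda0 CARD('g) (concat_seq ?e eb a')"
    using is_basis_of_extend[OF eb Int_lower1 subspace_lambda0] by (metis dim_lambda0)
  obtain c' where c': "is_basis_of ?K ?k (concat_seq ?e eb c')"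
    using is_basis_of_extend[OF eb EK K] .
  let ?al = "concat_seq ?e eb a'" and ?c = "concat_seq ?e eb c'"
  have ek: "?e \<le> ?k" using EK by (rule dim_subset)
  have al: "is_basis_of ?E ?e ?al"
    using eb by (subst is_basis_of_cong[of ?e ?al eb]) (simp_all add: concat_seq_def)
  obtain t0 where t0: "\<And>i j. i < ?k \<Longrightarrow> j < ?k \<Longrightarrow> omega (?c i) (t0 j) = (if i = j then 1 else 0)"
  proof (rule omega_dual_family_exists[OF subspace_UNIV, where m = ?k and c = ?c])
    fix p assume "\<And>w. w \<in> UNIV \<Longrightarrow> omega (\<Sum>i<?k. p i *\<^sub>R ?c i) w = 0"
    then have "(\<Sum>i<?k. p i *\<^sub>R ?c i) = 0" by (intro omega_nondegenerate) simp
    then show "\<forall>i<?k. p i = 0" using is_basis_of_coeff_zero[OF c'] by blast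
  qed blast
  obtain t1 where t1: "\<And>j. t1 j \<in> W"
    "\<And>i j. i < ?k - ?e \<Longrightarrow> j < ?k - ?e \<Longrightarrow> omega (c' i) (t1 j) = (if i = j then 1 else 0)"
  proof (rule omega_dual_family_exists[OF subspace_W, where m = "?k - ?e" and c = c'])
    fix p assume p: "\<And>w. w \<in> W \<Longrightarrow> omega (\<Sum>i<?k - ?e. p i *\<^sub>R c' i) w = 0"
    let ?v = "\<Sum>i<?k - ?e. p i *\<^sub>R c' i"
    have "omega w ?v = 0" if "w \<in> W" for w
      using p[OF that] omega_swap[of w ?v] by simp
    then have "?v \<in> omega_perp W" by (simp add: omega_perp_def)
    then have "?v \<in> fixed" unfolding W_eq omega_perp_perp[OF subspace_fixed] .
    moreover have "c' i \<in> lambda0" if "i < ?k - ?e" for i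
      using is_basis_of_mem[OF c', of "i + ?e"] that by (simp add: concat_seq_def)
    then have "?v \<in> lambda0"
      by (intro subspace_sum subspace_mul subspace_lambda0) auto
    ultimately have "?v \<in> ?E" by simp
    then obtain u where u: "?v = (\<Sum>i<?e. u i *\<^sub>R eb i)" by (rule is_basis_of_coords[OF eb])
    \<comment> \<open>Subtracting the expression of \<open>?v\<close> in \<open>eb\<close> yields a
      relation in the basis \<open>?c\<close>.\<close>
    let ?w = "\<lambda>i. if i < ?e then - u i else p (i - ?e)"
    have "(\<Sum>i<?k. ?w i *\<^sub>R ?c i) = (\<Sum>i<?e + (?k - ?e). ?w i *\<^sub>R ?c i)" using ek by simp
    also have "\<dots> = (\<Sum>i<?e. ?w i *\<^sub>R ?c i) + (\<Sum>i<?k - ?e. ?w (?e + i) *\<^sub>R ?c (?e + i))"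
      by (rule sum_lessThan_add)
    also have "\<dots> = - (\<Sum>i<?e. u i *\<^sub>R eb i) + ?v"
      by (simp add: concat_seq_def sum_negf)
    also have "\<dots> = 0" using u by simp
    finally have w0: "?w i = 0" if "i < ?k" for i using is_basis_of_coeff_zero[OF c', of ?w i] that by blast
    show "\<forall>i<?k - ?e. p i = 0"
    proof (intro allI impI)
      fix i assume "i < ?k - ?e"
      then show "p i = 0" using w0[of "i + ?e"] by simp
    qed
  qed blast
  let ?t = "concat_seq ?e t0 t1"
  have dual: "omega (?c i) (?t j) = (if i = j then 1 else 0)" if ij: "i < ?k" "j < ?k" for i j
  proof (cases "j < ?e")
    case True
    then show ?thesis using t0[OF ij] by (simp add: concat_seq_def)
  next
    case False
    show ?thesis
    proof (cases "i < ?e")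
      case True
      have "eb i \<in> fixed" using is_basis_of_mem[OF eb True] by simp
      then show ?thesis using omega_fixed_W t1(1) True False by (auto simp: concat_seq_def)
    next
      case i: False
      then show ?thesis using False t1(2)[of "i - ?e" "j - ?e"] ij by (auto simp: concat_seq_def)
    qed
  qed
  show thesis
  proof (rule that[OF a' al c' _ dual])
    show "?c i = ?al i" if "i < ?e" for i using that by (simp add: concat_seq_def)
    show "?t j \<in> W" if "?e \<le> j" for j using that t1(1) by (simp add: concat_seq_def)
  qed
qed

end

section \<open>Comparison of the two functions\<close>

context symplectic_map
begin

text \<open>The four conclusions share one set of bases: besides the comparison of signs, these
  bases yield the nonvanishing and the dimension facts that the exponent of \<i> needs.\<close>

lemma sgn_det_star_eq_epsilon:
  assumes a: "is_basis_of lambda0 CARD('g) a"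
  defines "r \<equiv> dim (lambda0 \<inter> f ` lambda0) - dim (lambda0 \<inter> fixed)"
  shows "sgn_det_star f = (-1) ^ (neg_index (star f) U + r) * epsilon CARD('g) a (f \<circ> a)"
    and "sgn_det_star f \<noteq> 0"
    and "pos_index (star f) U + neg_index (star f) U + r = dim U"
    and "dim (lambda0 \<inter> fixed) \<le> dim (lambda0 \<inter> f ` lambda0)"
proof -
  define g where "g = CARD('g)"
  define e where "e = dim (lambda0 \<inter> fixed)"
  define k where "k = dim (lambda0 \<inter> f ` lambda0)"
  obtain n y where y: "is_basis_of U n y"
    and yo: "\<And>i j. i < n \<Longrightarrow> j < n \<Longrightarrow> i \<noteq> j \<Longrightarrow> form (y i) (y j) = 0"
    and pos: "pos_index (star f) U = card {i. i < n \<and> form (y i) (y i) > 0}"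
    and neg: "neg_index (star f) U = card {i. i < n \<and> form (y i) (y i) < 0}"
    and zero: "card {i. i < n \<and> form (y i) (y i) = 0} + e = k"
    unfolding e_def k_def by (rule orthogonal_basis_U) blast
  obtain al c t where al: "is_basis_of lambda0 g al" and eb: "is_basis_of (lambda0 \<inter> fixed) e al"
    and c: "is_basis_of (lambda0 \<inter> f ` lambda0) k c" and ca: "\<And>i. i < e \<Longrightarrow> c i = al i"
    and ct: "\<And>i j. i < k \<Longrightarrow> j < k \<Longrightarrow> omega (c i) (t j) = (if i = j then 1 else 0)"
    and tW: "\<And>j. e \<le> j \<Longrightarrow> t j \<in> W"
    unfolding g_def e_def k_def by (rule adapted_bases) blast
  have ek: "e \<le> k" using zero by simp
  have eg: "e \<le> g"
    unfolding e_def g_def dim_lambda0[symmetric] by (rule dim_subset) simp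
  have r: "r = k - e" by (simp add: r_def k_def e_def)
  have n: "dim U = n" by (rule is_basis_of_dim[OF y])
  \<comment> \<open>The isotropic members of \<open>y\<close> span the radical and number
    \<open>k - e\<close>; the others supply the rows still missing for a basis of
    \<open>W\<close>.\<close>
  define Z where "Z = {i. i < n \<and> form (y i) (y i) \<noteq> 0}"
  have finZ: "finite Z" by (simp add: Z_def)
  have ZD: "y i \<in> lambda0" "y i \<in> W" "form (y i) (y i) \<noteq> 0" if "i \<in> Z" for i
    using is_basis_of_mem[OF y, of i] that by (auto simp: Z_def)
  have Zo: "form (y i) (y j) = 0" if "i \<in> Z" "j \<in> Z" "i \<noteq> j" for i j
    using yo that by (simp add: Z_def)
  have cardZ: "card Z + (k - e) = n"
  proof -
    have "card Z + card {i. i < n \<and> form (y i) (y i) = 0} = card (Z \<union> {i. i < n \<and> form (y i) (y i) = 0})"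
      by (rule card_Un_disjoint[symmetric]) (auto simp: Z_def)
    also have "Z \<union> {i. i < n \<and> form (y i) (y i) = 0} = {..<n}" by (auto simp: Z_def)
    finally show ?thesis using zero by simp
  qed
  have "card {i. i < n \<and> form (y i) (y i) > 0} + card {i. i < n \<and> form (y i) (y i) < 0} =
     card ({i. i < n \<and> form (y i) (y i) > 0} \<union> {i. i < n \<and> form (y i) (y i) < 0})"
    by (rule card_Un_disjoint[symmetric]) auto
  also have "{i. i < n \<and> form (y i) (y i) > 0} \<union> {i. i < n \<and> form (y i) (y i) < 0} = Z"
    by (auto simp: Z_def)
  finally show "pos_index (star f) U + neg_index (star f) U + r = dim U"
    using pos neg cardZ by (simp add: r n)
  show "dim (lambda0 \<inter> fixed) \<le> dim (lambda0 \<inter> f ` lambda0)" using ek by (simp add: e_def k_def)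

  \<comment> \<open>Correcting the preimages of t by the Y makes the columns of the Y diagonal,
    and does not disturb the duality with c because the y lie in the lagrangian.\<close>
  define Y where "Y i = h (y i)" for i
  define T where "T j = h (t j) - (\<Sum>l\<in>Z. (omega (h (t j)) (y l) / form (y l) (y l)) *\<^sub>R Y l)" for j
  have dY: "d (Y i) = y i" if "i \<in> Z" for i using ZD[OF that] by (simp add: Y_def d_h)
  have YY: "omega (Y i) (y j) = form (y i) (y j)" for i j by (simp add: Y_def form_def)
  have TY: "omega (T j) (y l) = 0" if "l \<in> Z" for j l
  proof -
    have "omega (T j) (y l) = omega (h (t j)) (y l) -
        (\<Sum>i\<in>Z. (omega (h (t j)) (y i) / form (y i) (y i)) * form (y i) (y l))"
      by (simp add: T_def omega.diff_left omega.sum_left omega.scaleR_left YY)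
    also have "(\<Sum>i\<in>Z. (omega (h (t j)) (y i) / form (y i) (y i)) * form (y i) (y l)) =
        (\<Sum>i\<in>Z. if i = l then omega (h (t j)) (y l) else 0)"
      by (intro sum.cong refl) (use Zo ZD that in auto)
    finally show ?thesis using that finZ by simp
  qed
  have dT: "d (T j) = t j - (\<Sum>l\<in>Z. (omega (h (t j)) (y l) / form (y l) (y l)) *\<^sub>R y l)" if "e \<le> j" for j
  proof -
    have "d (T j) = d (h (t j)) - (\<Sum>l\<in>Z. (omega (h (t j)) (y l) / form (y l) (y l)) *\<^sub>R d (Y l))"
      unfolding T_def
      by (subst linear_diff[OF d_linear], subst linear_sum[OF d_linear]) (simp add: linear_cmul[OF d_linear])
    then show ?thesis using tW[OF that] dY by (simp add: d_h)
  qed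
  have cL: "c i \<in> lambda0" "c i \<in> f ` lambda0" if "i < k" for i using is_basis_of_mem[OF c that] by auto
  have cT: "omega (c i) (d (T j)) = (if i = j then 1 else 0)" if "i < k" "e \<le> j" "j < k" for i j
  proof -
    have "omega (c i) (\<Sum>l\<in>Z. (omega (h (t j)) (y l) / form (y l) (y l)) *\<^sub>R y l) = 0"
      using lambda0_isotropic[OF cL(1)[OF that(1)]] ZD by (simp add: omega.sum_right omega.scaleR_right)
    then show ?thesis using ct that by (simp add: dT omega.diff_right)
  qed
  \<comment> \<open>Below \<open>e\<close> a dual vector has no preimage under \<open>d\<close>, so
    \<open>t\<close> is kept; from \<open>e\<close> on the dual vector is replaced by
    \<open>d (T j)\<close>.\<close>
  define tt where "tt j = (if j < e then t j else d (T j))" for j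
  have ctt: "omega (c i) (tt j) = (if i = j then 1 else 0)" if "i < k" "j < k" for i j
    using that ct cT by (simp add: tt_def)
  have alL: "al i \<in> lambda0" if "i < g" for i using is_basis_of_mem[OF al that] .
  have al0: "omega (al i) (al j) = 0" if "i < g" "j < g" for i j
    using lambda0_isotropic alL that by blast
  have fal: "f (al i) = al i" if "i < e" for i
    using is_basis_of_mem[OF eb that] by (simp add: fixed_def)

  \<comment> \<open>The corner is arbitrary in the bordered determinant; this choice turns the bordered matrix,
    after removing the pairs indexed below e, into a Gram matrix with some rows negated.\<close>
  define C where "C i j = (if i < e \<or> j < e then 0 else - omega (T i) (d (T j)))" for i j
  let ?I = "{..<g} <+> {..<k}"
  let ?M = "bordered al (f \<circ> al) tt C"
  have eps: "epsilon g a (f \<circ> a) = sgn_int (detS ?I ?M)"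
  proof -
    have fb: "is_basis_of (f ` lambda0) g (f \<circ> a)"
    proof -
      have inj: "inj_on f S" for S using inj_on_subset[OF inj_f subset_UNIV] .
      have "independent (f ` a ` {..<g})"
        by (rule linear_independent_injective_image[OF f_linear _ inj])
           (use a in \<open>simp add: is_basis_of_def g_def\<close>)
      then show ?thesis
        using a inj unfolding is_basis_of_def g_def image_comp[symmetric]
        by (auto simp: linear_span_image[OF f_linear] intro: comp_inj_on)
    qed
    have "epsilon g a (f \<circ> a) = sgn_int (detS ?I (bordered a (f \<circ> a) tt C))"
    proof (rule epsilon_eq_sgn_bordered[OF a[folded g_def] fb _ _ c ctt])
      show "omega x y = 0" if "x \<in> lambda0" "y \<in> lambda0" for x y :: "'g symvec"
        using that by (rule lambda0_isotropic)
      show "omega x y = 0" if "x \<in> f ` lambda0" "y \<in> f ` lambda0" for x y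
        using that lambda0_isotropic by auto
    qed
    \<comment> \<open>Passing from \<open>a\<close> to \<open>al\<close> changes both lagrangians by
      the same \<open>P\<close>, so the determinant changes by a square.\<close>
    moreover obtain P Q where P: "\<And>j. j < g \<Longrightarrow> al j = (\<Sum>i<g. P i j *\<^sub>R a i)"
      and PQ: "detS {..<g} Q * detS {..<g} P = 1"
      by (rule is_basis_of_transition[OF a[folded g_def] al]) blast
    have fP: "(f \<circ> al) j = (\<Sum>i<g. P i j *\<^sub>R (f \<circ> a) i)" if "j < g" for j
      by (simp add: P[OF that] linear_sum[OF f_linear] linear_cmul[OF f_linear])
    have "detS ?I ?M = detS {..<g} P * (detS {..<g} P * detS ?I (bordered a (f \<circ> a) tt C))"
      by (simp only: detS_bordered_change_left[of g al P a, OF P]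
        detS_bordered_change_right[of g "f \<circ> al" P "f \<circ> a", OF fP])
    moreover have "sgn_int (detS {..<g} P) * sgn_int (detS {..<g} P) = 1"
      using PQ by (auto simp: sgn_int_def)
    ultimately show ?thesis by (simp add: sgn_int_mult mult.assoc[symmetric])
  qed

  define A :: "(nat + nat) set" where "A = Inl ` {e..<g} \<union> Inr ` {e..<k}"
  have finA: "finite A" by (simp add: A_def)
  define x where "x u = (case u of Inl i \<Rightarrow> al i | Inr j \<Rightarrow> T j)" for u
  have MA: "detS ?I ?M = detS A ?M"
  proof -
    have "?I = Inl ` {..<e} \<union> Inr ` {..<e} \<union> A"
      using eg ek by (auto simp: A_def Plus_def image_iff)
    \<comment> \<open>For \<open>i < e\<close> the vector \<open>al i\<close> is fixed by
      \<open>f\<close>, so it vanishes against the whole lagrangian and its image, and it pairs only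
      with its own dual \<open>t i\<close>.\<close>
    moreover have "detS (Inl ` {..<e} \<union> Inr ` {..<e} \<union> A) ?M = detS A ?M"
    proof (rule detS_hyperbolic_pairs)
      have z1: "omega (al i) (f (al j)) = 0" if "i < e" "j < g" for i j
        using f_omega[of "al i" "al j"] fal[OF that(1)] al0[of i j] that eg by simp
      have z2: "omega (al j) (f (al i)) = 0" if "i < e" "j < g" for i j
        using fal[OF that(1)] al0[of j i] that eg by simp
      have z3: "omega (al i) (tt j) = (if i = j then 1 else 0)" if "i < e" "j < k" for i j
        using ctt[of i j] ca[of i] that ek by simp
      have z4: "omega (tt j) (f (al i)) = (if i = j then -1 else 0)" if "i < e" "j < k" for i j
        using z3[OF that] fal[OF that(1)] omega_swap[of "tt j" "al i"] by simp
      show "?M (Inl i) (Inl j) = 0" if "i \<in> {..<e}" "j \<in> {..<e}" for i j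
        using z1 that eg by simp
      show "?M (Inl i) u = 0" if "i \<in> {..<e}" "u \<in> A" for i u
        using z1 z3 that by (auto simp: A_def)
      show "?M u (Inl i) = 0" if "i \<in> {..<e}" "u \<in> A" for i u
        using z2 z4 that by (auto simp: A_def)
      show "?M (Inl i) (Inr j) = (if i = j then 1 else 0)" if "i \<in> {..<e}" "j \<in> {..<e}" for i j
        using z3 that ek by simp
      show "?M (Inr i) (Inl j) = (if i = j then -1 else 0)" if "i \<in> {..<e}" "j \<in> {..<e}" for i j
        using z4[of j i] that ek by auto
    qed (use finA in \<open>auto simp: A_def\<close>)
    ultimately show ?thesis by simp
  qed
  let ?G = "\<lambda>u v. omega (x u) (d (x v))"
  have MG: "detS A ?M = (-1) ^ r * detS A ?G"
  proof -
    \<comment> \<open>Rows of \<open>T\<close> are negated by \<open>omega_d_f\<close> and by the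
      choice of \<open>C\<close>. In rows of \<open>al\<close> the matrices agree:
      \<open>omega (al i) (f (al j))\<close> equals \<open>omega (al i) (d (al j))\<close> because
      \<open>lambda0\<close> is isotropic.\<close>
    let ?P = "\<lambda>u v :: nat + nat. if u = v then -1 else (0 :: real)"
    have "detS A ?M = detS (Inr ` {e..<k}) ?P * detS A ?G"
    proof (rule detS_change_rows[OF finA])
      show "Inr ` {e..<k} \<subseteq> A" by (simp add: A_def)
      fix u v :: "nat + nat" assume v: "v \<in> A"
      {
        assume "u \<in> Inr ` {e..<k}"
        then obtain i where i: "u = Inr i" "e \<le> i" "i < k" by auto
        have "?M u v = - ?G u v"
          using v i omega_d_f by (auto simp: A_def x_def tt_def C_def)
        also have "\<dots> = (\<Sum>l\<in>Inr ` {e..<k}. if u = l then - ?G l v else 0)" using i by simp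
        also have "\<dots> = (\<Sum>l\<in>Inr ` {e..<k}. ?P u l * ?G l v)" by (intro sum.cong) auto
        finally show "?M u v = (\<Sum>l\<in>Inr ` {e..<k}. ?P u l * ?G l v)" .
      }
      {
        assume "u \<in> A - Inr ` {e..<k}"
        then obtain i where i: "u = Inl i" "i < g" by (auto simp: A_def)
        show "?M u v = ?G u v"
          using v i al0 by (auto simp: A_def x_def tt_def omega.diff_right)
      }
    qed
    also have "detS (Inr ` {e..<k} :: (nat + nat) set) ?P = (\<Prod>u\<in>(Inr ` {e..<k} :: (nat + nat) set). -1)"
      by (subst detS_diagonal) auto
    also have "\<dots> = (-1) ^ r" by (simp add: card_image r)
    finally show ?thesis .
  qed

  define I3 :: "((nat + nat) + nat) set" where "I3 = Inl ` A \<union> Inr ` Z"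
  define X where "X p = (case p of Inl u \<Rightarrow> x u | Inr i \<Rightarrow> Y i)" for p
  let ?H = "\<lambda>p q. omega (X p) (d (X q))"
  have H: "detS I3 ?H = (\<Prod>i\<in>Z. form (y i) (y i)) * detS A ?G"
  proof -
    \<comment> \<open>The column of \<open>Y l\<close> pairs with \<open>d (Y l) = y l\<close>. Off
      the diagonal it vanishes against \<open>al\<close> by isotropy, against \<open>T\<close> by
      the correction, and against the other \<open>Y\<close> by orthogonality of
      \<open>y\<close>.\<close>
    have "detS I3 ?H = (\<Prod>p\<in>Inr ` Z. ?H p p) * detS (Inl ` A) ?H"
      unfolding I3_def
    proof (rule detS_union_unit_cols)
      fix p q assume p: "p \<in> Inr ` Z" and q: "q \<in> Inl ` A \<union> Inr ` Z" and "p \<noteq> q"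
      then obtain l where l: "p = Inr l" "l \<in> Z" by auto
      have "d (X p) = y l" using l dY by (simp add: X_def)
      moreover have "omega (X q) (y l) = 0"
        using q
      proof
        assume "q \<in> Inl ` A"
        then show ?thesis
          using TY[OF l(2)] lambda0_isotropic[OF alL ZD(1)[OF l(2)]] by (auto simp: X_def x_def A_def)
      next
        assume "q \<in> Inr ` Z"
        then obtain i where "q = Inr i" "i \<in> Z" by auto
        then show ?thesis using l \<open>p \<noteq> q\<close> Zo[of i l] by (simp add: X_def YY)
      qed
      ultimately show "?H q p = 0" by simp
    qed (use finA finZ in auto)
    also have "(\<Prod>p\<in>Inr ` Z. ?H p p) = (\<Prod>i\<in>Z. form (y i) (y i))"
      by (subst prod.reindex) (auto simp: X_def YY dY intro!: prod.cong)
    also have "detS (Inl ` A) ?H = detS A ?G"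
      by (simp add: detS_Inl[OF finA] X_def)
    finally show ?thesis .
  qed
  have finI3: "finite I3" using finA finZ by (simp add: I3_def)
  have cardA: "card A = (g - e) + (k - e)"
    unfolding A_def by (subst card_Un_disjoint) (auto simp: card_image)
  have "card I3 = card A + card Z"
    unfolding I3_def using finA finZ by (subst card_Un_disjoint) (auto simp: card_image)
  \<comment> \<open>The count is (g - e) + (k - e) + (n - (k - e)) = n + g - e, and
    \<open>dim_U\<close> identifies it with \<open>dim W\<close>.\<close>
  then have cardI3: "card I3 = dim W"
    using cardZ cardA dim_U eg n by (simp add: e_def[symmetric] g_def[symmetric])
  obtain \<beta> where \<beta>: "bij_betw \<beta> {..<dim W} I3"
    using ex_bij_betw_nat_finite[OF finI3] cardI3 by (auto simp: lessThan_atLeast0)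
  define b where "b i = d (X (\<beta> i))" for i
  have bW: "b i \<in> W" for i by (simp add: b_def image_fm1_def)
  have basis: "is_basis_of W (dim W) b"
  proof (rule is_basis_ofI[OF subspace_W bW order_refl])
    fix p assume p: "(\<Sum>i<dim W. p i *\<^sub>R b i) = 0"
    define p' where "p' = p \<circ> the_inv_into {..<dim W} \<beta>"
    have p': "p' (\<beta> i) = p i" if "i < dim W" for i
      using \<beta> that by (simp add: p'_def the_inv_into_f_f bij_betw_def)
    have "0 = (\<Sum>i<dim W. p' (\<beta> i) *\<^sub>R d (X (\<beta> i)))" using p p' by (simp add: b_def)
    also have "\<dots> = (\<Sum>u\<in>I3. p' u *\<^sub>R d (X u))" by (rule sum.reindex_bij_betw[OF \<beta>])
    also have "\<dots> = (\<Sum>u\<in>A. p' (Inl u) *\<^sub>R d (x u)) + (\<Sum>l\<in>Z. p' (Inr l) *\<^sub>R d (Y l))"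
      unfolding I3_def using finA finZ
      by (subst sum.union_disjoint) (auto simp: sum.reindex X_def)
    also have "(\<Sum>u\<in>A. p' (Inl u) *\<^sub>R d (x u)) = (\<Sum>i\<in>{e..<g}. p' (Inl (Inl i)) *\<^sub>R d (al i)) +
        (\<Sum>j\<in>{e..<k}. p' (Inl (Inr j)) *\<^sub>R d (T j))"
      unfolding A_def by (subst sum.union_disjoint) (auto simp: sum.reindex x_def)
    also have "(\<Sum>l\<in>Z. p' (Inr l) *\<^sub>R d (Y l)) = (\<Sum>l\<in>Z. p' (Inr l) *\<^sub>R y l)" using dY by simp
    finally have z: "(\<Sum>i\<in>{e..<g}. p' (Inl (Inl i)) *\<^sub>R d (al i)) +
        (\<Sum>j\<in>{e..<k}. p' (Inl (Inr j)) *\<^sub>R d (T j)) + (\<Sum>l\<in>Z. p' (Inr l) *\<^sub>R y l) = 0" by simp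
    have "(\<forall>i\<in>{e..<g}. p' (Inl (Inl i)) = 0) \<and> (\<forall>j\<in>{e..<k}. p' (Inl (Inr j)) = 0) \<and> (\<forall>l\<in>Z. p' (Inr l) = 0)"
      by (rule independent_d_family[OF eg ek al eb _ _ _ finZ _ _ z, of c])
         (use cL cT ZD Zo in auto)
    then have "p' u = 0" if "u \<in> I3" for u using that by (auto simp: I3_def A_def)
    then show "\<forall>i<dim W. p i = 0" using p' \<beta> by (metis bij_betwE lessThan_iff)
  qed
  have Hb: "detS I3 ?H = detS {..<dim W} (\<lambda>i j. form (b i) (b j))"
  proof -
    have "detS I3 ?H = detS {..<dim W} (\<lambda>i j. ?H (\<beta> i) (\<beta> j))"
      by (rule detS_reindex[OF _ \<beta>]) simp
    \<comment> \<open>By \<open>form_d\<close> an entry \<open>omega (X p) (d (X q))\<close> is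
      \<open>form\<close> on the two images under \<open>d\<close>.\<close>
    also have "\<dots> = detS {..<dim W} (\<lambda>i j. form (b i) (b j))"
      using form_d bW by (simp add: b_def)
    finally show ?thesis .
  qed
  have S: "sgn_det_star f = sgn_int (detS I3 ?H)" unfolding Hb by (rule sgn_det_star_eq[OF basis])
  show "sgn_det_star f \<noteq> 0"
    using S form_gram_nonzero[OF basis] unfolding Hb by (auto simp: sgn_int_def)
  have sG: "epsilon g a (f \<circ> a) = (-1) ^ r * sgn_int (detS A ?G)"
  proof -
    have "sgn_int ((-1) ^ r) = (-1) ^ r" by (cases "even r") (auto simp: sgn_int_def)
    then show ?thesis using eps MA MG by (simp add: sgn_int_mult)
  qed
  have "sgn_int (\<Prod>i\<in>Z. form (y i) (y i)) = (-1) ^ card {i \<in> Z. form (y i) (y i) < 0}"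
    using sgn_int_prod[OF finZ] prod_sgn_int_nonzero[OF finZ] ZD(3) by simp
  also have "{i \<in> Z. form (y i) (y i) < 0} = {i. i < n \<and> form (y i) (y i) < 0}"
    by (auto simp: Z_def)
  finally have "sgn_det_star f = (-1) ^ neg_index (star f) U * sgn_int (detS A ?G)"
    using S H neg by (simp add: sgn_int_mult)
  also have "sgn_int (detS A ?G) = (-1) ^ r * epsilon g a (f \<circ> a)"
    unfolding sG by (simp add: mult.assoc[symmetric] power_add[symmetric])
  finally show "sgn_det_star f = (-1) ^ (neg_index (star f) U + r) * epsilon CARD('g) a (f \<circ> a)"
    by (simp add: power_add g_def)
qed

text \<open>Let s be the sign of the discriminant, g = dim L and r = k - e. The dimension identities
  turn -n(f) into (g - k) + 2 (q + r) + (s - 1). The first summand is the exponent in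
  \<open>s_pair\<close>; the other two contribute (-1)^(q + r) and s, whose product is \<epsilon> by
  the comparison of signs.\<close>

lemma s_LV_eq: "s_LV f = \<i> powi (- n_GM f)"
proof -
  define a where "a = (SOME a. is_basis_of (lambda0 :: 'g symvec set) CARD('g) a)"
  have "\<exists>a. is_basis_of (lambda0 :: 'g symvec set) CARD('g) a"
    using is_basis_of_exists[OF subspace_lambda0] unfolding dim_lambda0 by metis
  then have a: "is_basis_of (lambda0 :: 'g symvec set) CARD('g) a" unfolding a_def by (rule someI_ex)
  define k e q where "k = dim (lambda0 \<inter> f ` lambda0)" and "e = dim (lambda0 \<inter> fixed)"
    and "q = neg_index (star f) U"
  note main = sgn_det_star_eq_epsilon[OF a, folded k_def e_def q_def]
  have spa: "span (a ` {..<CARD('g)}) = lambda0" using a by (simp add: is_basis_of_def)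
  have spfa: "span ((f \<circ> a) ` {..<CARD('g)}) = f ` lambda0"
    unfolding image_comp[symmetric] linear_span_image[OF f_linear] spa ..
  \<comment> \<open>Makes the truncated subtraction in the exponent a true difference.\<close>
  have kg: "k \<le> CARD('g)"
    unfolding k_def dim_lambda0[symmetric] by (rule dim_subset) simp
  have s: "s_LV f = \<i> ^ (CARD('g) - k) * of_int (epsilon CARD('g) a (f \<circ> a))"
    unfolding s_LV_def Let_def s_pair_def a_def[symmetric] spa spfa dim_lambda0 k_def ..
  \<comment> \<open>Nondegeneracy excludes the value 0 of \<open>sgn_int\<close>.\<close>
  have S: "sgn_det_star f = 1 \<or> sgn_det_star f = -1"
    using main(2) by (auto simp: sgn_det_star_def Let_def sgn_int_def split: if_splits)
  have "- n_GM f = int (CARD('g) - k) + (int (2 * (q + (k - e))) + (sgn_det_star f - 1))"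
    using main(3,4) dim_U kg unfolding n_GM_def signature_def e_def[symmetric] q_def[symmetric]
    by simp
  then have "\<i> powi (- n_GM f) = \<i> ^ (CARD('g) - k) * (\<i> ^ (2 * (q + (k - e))) * \<i> powi (sgn_det_star f - 1))"
    by (simp only: power_int_add complex_i_not_zero power_int_of_nat simp_thms)
  also have "\<i> ^ (2 * (q + (k - e))) = (-1) ^ (q + (k - e))"
    by (simp add: power_mult)
  \<comment> \<open>\<open>\<i> powi 0\<close> is 1 and \<open>\<i> powi (-2)\<close> is -1; this is
    the purpose of the summand 1 - s in \<open>n_GM\<close>.\<close>
  also have "\<i> powi (sgn_det_star f - 1) = of_int (sgn_det_star f)"
    using S by (auto simp: power_int_def)
  also have "(-1) ^ (q + (k - e)) * of_int (sgn_det_star f) = (of_int (epsilon CARD('g) a (f \<circ> a)) :: complex)"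
    unfolding main(1) by (simp add: mult.assoc[symmetric] power_add[symmetric])
  finally show ?thesis using s by simp
qed

end

theorem theorem1p1:
  fixes f :: "'g::finite symvec \<Rightarrow> 'g symvec"
  assumes "f \<in> Sp_Z"
  shows "s_LV f = \<i> powi (- n_GM f)"
proof -
  have "symplectic_map f"
    using assms by (simp add: symplectic_map_def Sp_Z_def)
  then show ?thesis by (rule symplectic_map.s_LV_eq)
qed

end
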